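(* Let $n\ge2$ and let $\Omega$ be a convex polytope in $\mathbb R^n$. If there exists a convex function $u\in C^2(\overline\Omega)$ satisfying the A-condition (at every point of $\Gamma_{n-2}(\Omega)$), then $\Omega$ is simple. Conversely, if $n=2$ or $n=3$ and $\Omega$ is a simple convex polytope in $\mathbb R^n$, then there exists a convex function $u\in C^2(\overline\Omega)$ satisfying the A-condition (at every point of $\Gamma_{n-2}(\Omega)$).
   Context: Polytopes are convex, bounded, with nonempty interior. $\Gamma_k(\Omega)$ is the $k$-skeleton of $\Omega$, i.e. the union of the faces of dimension at most $k$. Two $(n-1)$-faces $F,\tilde F$ are adjacent if $F\cap\tilde F$ contains an $(n-2)$-face. A polytope in $\mathbb R^n$ is simple if the tangent cone at each of its vertices is equivalent to $(\mathbb R_+)^n$ after an affine transformation. Let $u\in C^2(\overline\Omega)$ be uniformly convex and $x_0\in\Gamma_{n-2}(\Omega)$. Choose an affine transformation $T$ such that $v(x)=u(Tx)$ satisfies $D^2v(T^{-1}x_0)=I_{n\times n}$, and let $V$ be the tangent cone of $T^{-1}(\Omega)$ at $T^{-1}(x_0)$. Then $\Theta(u,x_0,\Omega)$ is the maximum dihedral angle between adjacent $(n-1)$-faces of $V$, and $u$ satisfies the A-condition at $x_0$ if $\Theta(u,x_0,\Omega)\le\frac\pi2$. (The A-condition is only defined for uniformly convex $u$, so "satisfying the A-condition" includes uniform convexity of $u$.) *)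

theory Defs
  imports "HOL-Analysis.Analysis"
begin

text \<open>A polytope $\Omega$ is represented by the closed set $\overline\Omega$
  (the library predicate \<^term>\<open>polytope\<close>); nonempty interior is a separate hypothesis.\<close>

definition skeleton :: "nat \<Rightarrow> (real ^ 'n) set \<Rightarrow> (real ^ 'n) set" where
  "skeleton k S = \<Union> {F. F face_of S \<and> aff_dim F \<le> int k}"

text \<open>The cone of directions, with apex moved to the origin. For a polyhedron this set is
  already closed, so no closure is taken.\<close>

definition tangent_cone :: "(real ^ 'n) set \<Rightarrow> real ^ 'n \<Rightarrow> (real ^ 'n) set" where
  "tangent_cone S x = {t *\<^sub>R (y - x) | t y. 0 \<le> t \<and> y \<in> S}"

definition affine_transformation :: "(real ^ 'n \<Rightarrow> real ^ 'n) \<Rightarrow> bool" where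
  "affine_transformation T \<longleftrightarrow>
     (\<exists>A b. invertible (A :: real ^ 'n ^ 'n) \<and> T = (\<lambda>x. A *v x + b))"

definition simple_polytope :: "(real ^ 'n) set \<Rightarrow> bool" where
  "simple_polytope S \<longleftrightarrow>
     (\<forall>x. x extreme_point_of S \<longrightarrow>
        (\<exists>T. affine_transformation T \<and> T ` tangent_cone S x = {y. \<forall>i. 0 \<le> y $ i}))"

text \<open>$C^2(\overline\Omega)$ for a closed set \<open>S\<close> standing for $\overline\Omega$: the function is
  $C^2$ in the interior, and it and its first and second derivatives extend continuously to \<open>S\<close>.
  Here \<open>g\<close> and \<open>H\<close> are the extended gradient and Hessian.\<close>

definition C2_derivs ::
  "(real ^ 'n) set \<Rightarrow> (real ^ 'n \<Rightarrow> real) \<Rightarrow> (real ^ 'n \<Rightarrow> real ^ 'n) \<Rightarrow> (real ^ 'n \<Rightarrow> real ^ 'n ^ 'n) \<Rightarrow> bool"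
where
  "C2_derivs S f g H \<longleftrightarrow>
     (\<forall>x \<in> interior S. (f has_derivative (\<lambda>h. g x \<bullet> h)) (at x)) \<and>
     (\<forall>x \<in> interior S. (g has_derivative (\<lambda>h. H x *v h)) (at x)) \<and>
     continuous_on S f \<and> continuous_on S g \<and> continuous_on S H"

definition C2_on :: "(real ^ 'n) set \<Rightarrow> (real ^ 'n \<Rightarrow> real) \<Rightarrow> bool" where
  "C2_on S f \<longleftrightarrow> (\<exists>g H. C2_derivs S f g H)"

text \<open>The value at \<open>x \<in> S\<close>, boundary included, of the continuous extension of $D^2 f$. It is
  uniquely determined when \<open>C2_on S f\<close> and \<open>S\<close> is the closure of its interior.\<close>

definition hessian :: "(real ^ 'n) set \<Rightarrow> (real ^ 'n \<Rightarrow> real) \<Rightarrow> real ^ 'n \<Rightarrow> real ^ 'n ^ 'n" where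
  "hessian S f x = (THE M. \<exists>g H. C2_derivs S f g H \<and> H x = M)"

text \<open>$D^2 u \ge c\,I$ on all of $\overline\Omega$ for some $c > 0$.\<close>

definition uniformly_convex :: "(real ^ 'n) set \<Rightarrow> (real ^ 'n \<Rightarrow> real) \<Rightarrow> bool" where
  "uniformly_convex S u \<longleftrightarrow> C2_on S u \<and>
     (\<exists>c>0. \<forall>x\<in>S. \<forall>\<xi>. \<xi> \<bullet> (hessian S u x *v \<xi>) \<ge> c * (norm \<xi>)\<^sup>2)"

definition adjacent_facets :: "(real ^ 'n) set \<Rightarrow> (real ^ 'n) set \<Rightarrow> (real ^ 'n) set \<Rightarrow> bool" where
  "adjacent_facets V F G \<longleftrightarrow> F facet_of V \<and> G facet_of V \<and> F \<noteq> G \<and>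
     (\<exists>R. R face_of V \<and> aff_dim R = int CARD('n) - 2 \<and> R \<subseteq> F \<inter> G)"

text \<open>Unique when \<open>V\<close> is convex with nonempty interior and \<open>F\<close> is a facet of \<open>V\<close>.\<close>

definition outer_normal :: "(real ^ 'n) set \<Rightarrow> (real ^ 'n) set \<Rightarrow> real ^ 'n" where
  "outer_normal V F = (THE \<nu>. norm \<nu> = 1 \<and>
     (\<exists>c. (\<forall>x\<in>V. \<nu> \<bullet> x \<le> c) \<and> (\<forall>x\<in>F. \<nu> \<bullet> x = c)))"

text \<open>The interior angle of \<open>V\<close> between \<open>F\<close> and \<open>G\<close>: \<open>\<pi>\<close> minus the angle between the outer
  unit normals.\<close>

definition dihedral_angle :: "(real ^ 'n) set \<Rightarrow> (real ^ 'n) set \<Rightarrow> (real ^ 'n) set \<Rightarrow> real" where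
  "dihedral_angle V F G = pi - arccos (outer_normal V F \<bullet> outer_normal V G)"

text \<open>Two admissible choices of \<open>T\<close> differ by a Euclidean isometry, so the value does not depend
  on the choice. An admissible \<open>T\<close> exists when \<open>u\<close> is uniformly convex on a convex \<open>\<Omega>\<close> with
  nonempty interior and \<open>x0 \<in> \<Omega>\<close>.\<close>

definition Theta :: "(real ^ 'n \<Rightarrow> real) \<Rightarrow> real ^ 'n \<Rightarrow> (real ^ 'n) set \<Rightarrow> real" where
  "Theta u x0 \<Omega> =
     (let T = (SOME T. affine_transformation T \<and> hessian (T -` \<Omega>) (u \<circ> T) (inv T x0) = mat 1);
          V = tangent_cone (T -` \<Omega>) (inv T x0)
      in Max {dihedral_angle V F G | F G. adjacent_facets V F G})"

definition A_condition_at :: "(real ^ 'n \<Rightarrow> real) \<Rightarrow> real ^ 'n \<Rightarrow> (real ^ 'n) set \<Rightarrow> bool" where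
  "A_condition_at u x0 \<Omega> \<longleftrightarrow> uniformly_convex \<Omega> u \<and> Theta u x0 \<Omega> \<le> pi / 2"

definition A_condition :: "(real ^ 'n \<Rightarrow> real) \<Rightarrow> (real ^ 'n) set \<Rightarrow> bool" where
  "A_condition u \<Omega> \<longleftrightarrow> (\<forall>x0 \<in> skeleton (CARD('n) - 2) \<Omega>. A_condition_at u x0 \<Omega>)"

end

(*
If A^T D^2u(x) A = I, the facet of A^{-1} Omega with normal A^T n makes a nonobtuse angle with the one with
normal A^T n' iff n . D^2u(x)^{-1} n' <= 0.

A-condition implies simple: in a polyhedral cone whose adjacent facets meet at nonobtuse angles, orthogonal
projection onto a facet hyperplane maps the cone into that facet, so the normals of any two facets have
nonpositive inner product. Vectors in an open half-space with this property are linearly independent; hence a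
pointed cone of this kind is simplicial.

Simple implies A-condition for n = 2, 3: with l_F the distance to the facet F, take
u = |x|^2/2 + K sum_{F /= G} (max 0 (delta - l_F - l_G))^3 for small delta and large K. At a point of F and G at
most one further facet is at distance less than delta, and the mixed second derivative transversal to F and G
dominates.
*)
theory Submission
  imports Defs
begin

section \<open>Facets of polyhedra and their normals\<close>

text \<open>Large \<open>K\<close> works because n' = D^2u z makes z nearly orthogonal to n + n',
  while n' . z = z . D^2u z is nonnegative; this suggests n . z <= 0. The obstacle is that an exact
  sign is wanted, with one \<open>K\<close> for all points, and that along an edge the two terms of
  a third facet fade in with a weight running through [0, 1]; no limit in \<open>K\<close> alone
  covers small weights. An exact cofactor identity does. The third power is the least integer power
  that is twice continuously differentiable, and it makes that weight an affine function of the
  distance to the third facet. Simplicity enters as linear independence of the normals of all facets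
  near a point: it excludes parallel n and n', keeps the third normal outside their span, and bounds
  the number of near facets by the dimension. Two choices in the definition of Theta need care: the
  maximum is meaningful only if adjacent facets exist, and the existence of a normalising T rests on
  the symmetry of the Hessian up to the boundary.\<close>

lemma polyhedron_exit_facet:
  fixes S :: "'a::euclidean_space set"
  assumes S: "polyhedron S" and q: "q \<in> rel_interior S" and x: "x \<in> affine hull S" "x \<notin> S"
  obtains R t where "R facet_of S" "0 < t" "t < 1" "(1 - t) *\<^sub>R q + t *\<^sub>R x \<in> R"
proof -
  obtain T where T: "open T" "rel_interior S = affine hull S \<inter> T"
    using openin_rel_interior[of S] unfolding openin_open by auto
  have q': "q \<in> S" "q \<in> T" using q T rel_interior_subset by auto
  have sub: "closed_segment q x \<subseteq> affine hull S"
    using x(1) q'(1) by (metis affine_affine_hull affine_imp_convex closed_segment_subset hull_inc)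
  have "\<exists>z \<in> closed_segment q x. z \<in> S \<and> z \<notin> rel_interior S"
  proof (rule ccontr)
    assume "\<not> ?thesis"
    \<comment> \<open>Otherwise the open sets \<open>T\<close> and \<open>- S\<close> would
      disconnect the segment: they are disjoint on it because \<open>T\<close> meets the affine hull
      only in the relative interior.\<close>
    then have "closed_segment q x \<subseteq> T \<union> - S" "T \<inter> - S \<inter> closed_segment q x = {}"
      using T sub rel_interior_subset[of S] by blast+
    moreover have "open (- S)"
      using S by (simp add: polyhedron_imp_closed open_Compl)
    ultimately have "T \<inter> closed_segment q x = {} \<or> - S \<inter> closed_segment q x = {}"
      using connectedD[OF convex_connected[OF convex_closed_segment]] T(1) by blast
    then show False using q' x(2) by auto
  qed
  then obtain z where z: "z \<in> closed_segment q x" "z \<in> S" "z \<notin> rel_interior S" by blast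
  then obtain t where t: "0 \<le> t" "t \<le> 1" "z = (1 - t) *\<^sub>R q + t *\<^sub>R x"
    unfolding closed_segment_def by auto
  have "t \<noteq> 0" "t \<noteq> 1" using t z q x by auto
  then have "0 < t" "t < 1" using t by auto
  moreover obtain R where "R facet_of S" "z \<in> R"
    using z rel_boundary_of_polyhedron[OF S] by blast
  ultimately show ?thesis using that[of R t] t(3) by simp
qed

text \<open>Proper inclusion of faces lowers the dimension, and there is no dimension strictly
  between that of a facet and that of \<open>S\<close>.\<close>

lemma facet_subset_face_eq:
  fixes S :: "'a::euclidean_space set"
  assumes "convex S" "F facet_of S" "G face_of S" "G \<noteq> S" "F \<subseteq> G"
  shows "F = G"
proof (rule ccontr)
  assume "F \<noteq> G"
  have "F face_of G"
    using assms face_of_subset facet_of_imp_face_of face_of_imp_subset by metis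
  then have "aff_dim F < aff_dim G"
    using \<open>F \<noteq> G\<close> assms face_of_aff_dim_lt face_of_imp_convex by metis
  moreover have "aff_dim G < aff_dim S"
    using assms face_of_aff_dim_lt by metis
  ultimately show False using assms(2) unfolding facet_of_def by linarith
qed

lemma facet_affine_hull:
  fixes S :: "'a::euclidean_space set"
  assumes int: "interior S \<noteq> {}" and F: "F facet_of S" and n: "n \<noteq> 0" "\<forall>x\<in>F. n \<bullet> x = c"
  shows "affine hull F = {x. n \<bullet> x = c}"
proof -
  have "aff_dim F = DIM('a) - 1"
    using F int unfolding facet_of_def by (auto simp: aff_dim_nonempty_interior)
  then have "affine hull F = affine hull {x. n \<bullet> x = c}"
    using n by (intro aff_dim_eq_full_gen[THEN iffD1]) (auto simp: aff_dim_hyperplane)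
  then show ?thesis by (simp add: affine_hyperplane)
qed

text \<open>Adding the part \<open>w\<close> of \<open>a\<close> orthogonal to \<open>n\<close> to a
  point of \<open>F\<close> stays in the hyperplane spanned by \<open>F\<close>, where
  \<open>a\<close> is constant. So \<open>a\<close>, and with it \<open>w\<close>, is orthogonal to
  \<open>w\<close>. It gives uniqueness of normals here and later identifies the coordinates of an
  orthant with facet normals.\<close>

lemma facet_functional_parallel:
  fixes S :: "'a::euclidean_space set"
  assumes int: "interior S \<noteq> {}" and F: "F facet_of S"
    and n: "norm n = 1" "\<forall>x\<in>F. n \<bullet> x = c" and a: "\<forall>x\<in>F. a \<bullet> x = e"
  shows "a = (n \<bullet> a) *\<^sub>R n"
proof -
  have "n \<noteq> 0" using n by auto
  then have "affine hull F = {x. n \<bullet> x = c}" using facet_affine_hull[OF int F _ n(2)] by blast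
  moreover have "affine hull F \<subseteq> {x. a \<bullet> x = e}"
    using a by (intro hull_minimal) (auto simp: affine_hyperplane)
  ultimately have sub: "\<And>x. n \<bullet> x = c \<Longrightarrow> a \<bullet> x = e" by auto
  define w where "w = a - (n \<bullet> a) *\<^sub>R n"
  obtain y where y: "y \<in> F" using F unfolding facet_of_def by auto
  have "n \<bullet> n = 1" using n by (simp add: norm_eq_1)
  then have nw: "n \<bullet> w = 0" unfolding w_def by (simp add: inner_diff_right)
  then have "a \<bullet> (y + w) = e" using sub[of "y + w"] y n(2) by (simp add: inner_add_right)
  then have "a \<bullet> w = 0" using a y by (simp add: inner_add_right)
  then have "w \<bullet> w = 0" using nw unfolding w_def by (simp add: inner_diff_left)
  then show ?thesis unfolding w_def by simp
qed

lemma unit_normal_unique: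
  fixes S :: "'a::euclidean_space set"
  assumes int: "interior S \<noteq> {}" and F: "F facet_of S"
    and n: "norm n = 1" "\<forall>x\<in>S. n \<bullet> x \<le> c" "\<forall>x\<in>F. n \<bullet> x = c"
    and m: "norm m = 1" "\<forall>x\<in>S. m \<bullet> x \<le> d" "\<forall>x\<in>F. m \<bullet> x = d"
  shows "n = m"
proof -
  have S: "aff_dim S = DIM('a)"
    using int by (simp add: aff_dim_nonempty_interior)
  have n0: "n \<noteq> 0" using n by auto
  obtain y where y: "y \<in> F" using F unfolding facet_of_def by auto
  have mw: "m = (n \<bullet> m) *\<^sub>R n"
    by (rule facet_functional_parallel[OF int F n(1,3) m(3)])
  have "\<bar>n \<bullet> m\<bar> = 1" using mw m(1) n(1) by (metis mult.right_neutral norm_scaleR)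
  then consider "n \<bullet> m = 1" | "n \<bullet> m = -1" by linarith
  then show ?thesis
  proof cases
    case 1 then show ?thesis using mw by simp
  next
    case 2
    \<comment> \<open>Opposite outer normals would squeeze \<open>S\<close> into a
      hyperplane.\<close>
    then have mn: "m = - n" using mw by simp
    then have "d = - c" using y n(3) m(3) by (metis inner_minus_left)
    then have "S \<subseteq> {x. n \<bullet> x = c}" using n(2) m(2) mn by force
    then have "aff_dim S \<le> DIM('a) - 1"
      using aff_dim_subset[of S] n0 by (metis aff_dim_hyperplane)
    then show ?thesis using S by simp
  qed
qed

lemma outer_normal_eqI:
  fixes V :: "(real ^ 'n) set"
  assumes "interior V \<noteq> {}" "F facet_of V"
    and "norm n = 1" "\<forall>x\<in>V. n \<bullet> x \<le> c" "\<forall>x\<in>F. n \<bullet> x = c"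
  shows "outer_normal V F = n"
  unfolding outer_normal_def
proof (rule the_equality)
  show "norm n = 1 \<and> (\<exists>c. (\<forall>x\<in>V. n \<bullet> x \<le> c) \<and> (\<forall>x\<in>F. n \<bullet> x = c))"
    using assms by blast
next
  fix m assume "norm m = 1 \<and> (\<exists>c. (\<forall>x\<in>V. m \<bullet> x \<le> c) \<and> (\<forall>x\<in>F. m \<bullet> x = c))"
  then show "m = n" using unit_normal_unique assms by metis
qed

lemma facet_unit_normal:
  fixes S :: "'a::euclidean_space set"
  assumes "polyhedron S" "F facet_of S"
  shows "\<exists>n c. norm n = 1 \<and> (\<forall>x\<in>S. n \<bullet> x \<le> c) \<and> F = S \<inter> {x. n \<bullet> x = c}"
proof -
  obtain a b where ab: "a \<noteq> 0" "S \<subseteq> {x. a \<bullet> x \<le> b}" "F = S \<inter> {x. a \<bullet> x = b}"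
    using facet_of_polyhedron[OF assms] by metis
  have "norm (sgn a) = 1" using ab by (simp add: norm_sgn)
  moreover have "\<forall>x\<in>S. sgn a \<bullet> x \<le> b / norm a"
    using ab by (auto simp: sgn_div_norm divide_inverse mult.commute intro!: mult_right_mono)
  moreover have "F = S \<inter> {x. sgn a \<bullet> x = b / norm a}"
    using ab by (auto simp: sgn_div_norm divide_simps)
  ultimately show ?thesis by blast
qed

lemma outer_normal_props:
  fixes V :: "(real ^ 'n) set"
  assumes "polyhedron V" "interior V \<noteq> {}" "F facet_of V"
  shows "norm (outer_normal V F) = 1"
    and "\<exists>c. (\<forall>x\<in>V. outer_normal V F \<bullet> x \<le> c) \<and> F = V \<inter> {x. outer_normal V F \<bullet> x = c}"
proof -
  obtain n c where n: "norm n = 1" "\<forall>x\<in>V. n \<bullet> x \<le> c" "F = V \<inter> {x. n \<bullet> x = c}"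
    using facet_unit_normal[OF assms(1,3)] by blast
  then have "outer_normal V F = n" by (intro outer_normal_eqI[OF assms(2,3)]) auto
  with n show "norm (outer_normal V F) = 1"
    and "\<exists>c. (\<forall>x\<in>V. outer_normal V F \<bullet> x \<le> c) \<and> F = V \<inter> {x. outer_normal V F \<bullet> x = c}"
    by simp_all blast
qed

text \<open>From an interior point \<open>q\<close>, the segment to a point \<open>x\<close> outside
  \<open>S\<close> leaves through some facet \<open>R\<close>. The functional of \<open>R\<close> is
  below its bound at \<open>q\<close> and equal to it at the exit, hence above it at
  \<open>x\<close>.\<close>

lemma polyhedron_eq_facet_halfspaces:
  fixes S :: "'a::euclidean_space set"
  assumes S: "polyhedron S" "interior S \<noteq> {}"
    and n: "\<And>F. F facet_of S \<Longrightarrow> (\<forall>x\<in>S. n F \<bullet> x \<le> c F) \<and> F = S \<inter> {x. n F \<bullet> x = c F}"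
  shows "S = {x. \<forall>F. F facet_of S \<longrightarrow> n F \<bullet> x \<le> c F}" (is "S = ?T")
proof
  show "S \<subseteq> ?T" using n by auto
  show "?T \<subseteq> S"
  proof
    fix x assume x: "x \<in> ?T"
    show "x \<in> S"
    proof (rule ccontr)
      assume nx: "x \<notin> S"
      have dim: "aff_dim S = DIM('a)" using S by (simp add: aff_dim_nonempty_interior)
      then have hull: "affine hull S = UNIV"
        using aff_dim_eq_full by auto
      obtain q where q: "q \<in> rel_interior S"
        using S(2) hull by (auto simp: rel_interior_interior)
      obtain R t where R: "R facet_of S" "0 < t" "t < 1" "(1 - t) *\<^sub>R q + t *\<^sub>R x \<in> R"
        using polyhedron_exit_facet[OF S(1) q _ nx] hull by blast
      have "q \<notin> R" "q \<in> S"
        using q R(1) rel_boundary_of_polyhedron[OF S(1)] rel_interior_subset by blast+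
      then have qc: "n R \<bullet> q < c R" using n[OF R(1)] by force
      have "n R \<bullet> ((1 - t) *\<^sub>R q + t *\<^sub>R x) = c R" using n[OF R(1)] R(4) by blast
      then have "(1 - t) * (n R \<bullet> q) + t * (n R \<bullet> x) = c R"
        by (simp only: inner_add_right inner_scaleR_right)
      moreover have "(1 - t) * (n R \<bullet> q) < (1 - t) * c R" using qc R by simp
      moreover have "t * (n R \<bullet> x) \<le> t * c R" using x R by simp
      ultimately show False by (simp add: algebra_simps)
    qed
  qed
qed

text \<open>A proper face is the intersection of the facets containing it. If all facets through
  \<open>R\<close> contained \<open>F\<close>, so would \<open>R\<close>; any facet through
  \<open>R\<close> that does not contain \<open>F\<close> is the neighbour across the ridge.\<close>

lemma ridge_adjacent:
  fixes V :: "(real ^ 'n) set"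
  assumes V: "polyhedron V" "interior V \<noteq> {}" and F: "F facet_of V" and R: "R facet_of F"
  obtains G where "adjacent_facets V F G" "R \<subseteq> G"
proof -
  have Rf: "R face_of V" "R \<subseteq> F" "R \<noteq> F" "R \<noteq> {}"
    using R F face_of_trans unfolding facet_of_def by (auto dest: face_of_imp_subset)
  have "R \<noteq> V" using Rf F facet_of_imp_subset by fastforce
  then have Req: "R = \<Inter>{F. F facet_of V \<and> R \<subseteq> F}"
    using face_of_polyhedron[OF V(1) Rf(1)] Rf by blast
  obtain G where G: "G facet_of V" "R \<subseteq> G" "\<not> F \<subseteq> G"
  proof (rule ccontr)
    assume "\<not> thesis"
    then have "F \<subseteq> \<Inter>{F. F facet_of V \<and> R \<subseteq> F}" using that by blast
    then show False using Req Rf by blast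
  qed
  have "aff_dim V = int CARD('n)" using V by (simp add: aff_dim_nonempty_interior)
  then have "aff_dim R = int CARD('n) - 2"
    using R F unfolding facet_of_def by simp
  then have "adjacent_facets V F G"
    unfolding adjacent_facets_def using G F Rf by blast
  then show ?thesis using that G by blast
qed

text \<open>Projecting a point of the cone orthogonally onto a facet hyperplane lands in the facet, since
  only the adjacent facets bound it there; testing this on points of the other facets turns
  the sign condition for adjacent pairs into one for all pairs.\<close>

lemma nonobtuse_all_facets:
  fixes V :: "(real ^ 'n) set"
  assumes V: "polyhedron V" "interior V \<noteq> {}"
    and n: "\<And>F. F facet_of V \<Longrightarrow> norm (n F) = 1 \<and> (\<forall>x\<in>V. n F \<bullet> x \<le> 0) \<and> F = V \<inter> {x. n F \<bullet> x = 0}"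
    and adj: "\<And>F G. adjacent_facets V F G \<Longrightarrow> n F \<bullet> n G \<le> 0"
    and FG: "F facet_of V" "G facet_of V" "F \<noteq> G"
  shows "n F \<bullet> n G \<le> 0"
proof -
  have cv: "convex V" using V by (simp add: polyhedron_imp_convex)
  have proj: "p - (n F \<bullet> p) *\<^sub>R n F \<in> F" if p: "p \<in> V" for p
  proof (rule ccontr)
    let ?y = "p - (n F \<bullet> p) *\<^sub>R n F"
    assume ny: "?y \<notin> F"
    have pF: "polyhedron F" using V FG face_of_polyhedron_polyhedron facet_of_imp_face_of by blast
    have "n F \<bullet> n F = 1" using n[OF FG(1)] by (simp add: norm_eq_1)
    then have "n F \<bullet> ?y = 0" by (simp add: inner_diff_right)
    moreover have "n F \<noteq> 0" using n[OF FG(1)] by auto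
    then have "affine hull F = {x. n F \<bullet> x = 0}"
      using n[OF FG(1)] by (intro facet_affine_hull[OF V(2) FG(1)]) auto
    ultimately have yh: "?y \<in> affine hull F" by simp
    have "rel_interior F \<noteq> {}"
      using FG pF by (simp add: facet_of_def rel_interior_eq_empty polyhedron_imp_convex)
    then obtain q where q: "q \<in> rel_interior F" by blast
    obtain R t where R: "R facet_of F" "0 < t" "t < 1" "(1 - t) *\<^sub>R q + t *\<^sub>R ?y \<in> R"
      using polyhedron_exit_facet[OF pF q yh ny] by blast
    obtain H where H: "adjacent_facets V F H" "R \<subseteq> H"
      using ridge_adjacent[OF V FG(1) R(1)] by blast
    then have HF: "H facet_of V" "H \<noteq> F" unfolding adjacent_facets_def by auto
    have qF: "q \<in> F" "q \<in> V" using q rel_interior_subset facet_of_imp_subset[OF FG(1)] by blast+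
    have "q \<notin> H"
    proof
      assume "q \<in> H"
      then have "F \<subseteq> H"
        using subset_of_face_of[of H V F] q facet_of_imp_face_of[OF HF(1)] facet_of_imp_subset[OF FG(1)]
        by blast
      then show False
        using facet_subset_face_eq[OF cv FG(1) facet_of_imp_face_of[OF HF(1)]] HF by (metis facet_of_irrefl)
    qed
    then have "n H \<bullet> q < 0" using n[OF HF(1)] qF by force
    then have "(1 - t) * (n H \<bullet> q) < 0" using R by (simp add: mult_pos_neg)
    moreover have "n H \<bullet> ((1 - t) *\<^sub>R q + t *\<^sub>R ?y) = 0"
      using n[OF HF(1)] H(2) R(4) by blast
    then have "(1 - t) * (n H \<bullet> q) + t * (n H \<bullet> ?y) = 0"
      by (simp only: inner_add_right inner_scaleR_right)
    ultimately have "0 < t * (n H \<bullet> ?y)" by linarith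
    then have "0 < n H \<bullet> ?y" using R by (simp add: zero_less_mult_iff)
    \<comment> \<open>Both \<open>n F \<bullet> p\<close> and \<open>n F \<bullet> n H\<close> are
      nonpositive, so the projection cannot raise the value of \<open>n H\<close> above its value at
      \<open>p\<close>, which contradicts \<open>0 < n H \<bullet> ?y\<close>.\<close>
    moreover have "n H \<bullet> ?y = n H \<bullet> p - (n F \<bullet> p) * (n F \<bullet> n H)"
      by (simp add: inner_diff_right inner_commute)
    moreover have "0 \<le> (n F \<bullet> p) * (n F \<bullet> n H)"
      using n[OF FG(1)] p adj[OF H(1)] by (simp add: mult_nonpos_nonpos)
    moreover have "n H \<bullet> p \<le> 0" using n[OF HF(1)] p by simp
    ultimately show False by linarith
  qed
  \<comment> \<open>Test the projection on a point of \<open>G\<close> off \<open>F\<close>: its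
    image is still in \<open>V\<close>, and \<open>n G\<close> vanishes at \<open>p\<close>, so only
    the product of \<open>n F \<bullet> p < 0\<close> with the wanted inner product remains.\<close>
  obtain p where p: "p \<in> G" "p \<notin> F"
    using facet_subset_face_eq[OF cv FG(2) facet_of_imp_face_of[OF FG(1)]] FG by (metis facet_of_irrefl subsetI)
  then have pV: "p \<in> V" using FG facet_of_imp_subset by blast
  then have pn: "n F \<bullet> p < 0" using n[OF FG(1)] p(2) by force
  have "p - (n F \<bullet> p) *\<^sub>R n F \<in> V" using proj[OF pV] FG facet_of_imp_subset by blast
  then have "n G \<bullet> (p - (n F \<bullet> p) *\<^sub>R n F) \<le> 0" using n[OF FG(2)] by blast
  moreover have "n G \<bullet> p = 0" using n[OF FG(2)] p by blast
  ultimately have "0 \<le> (n F \<bullet> p) * (n F \<bullet> n G)"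
    by (simp add: inner_diff_right inner_commute)
  then show ?thesis using pn by (simp add: zero_le_mult_iff)
qed

text \<open>Split a linear relation by the sign of its coefficients: \<open>w\<close> is the
  positive part and also minus the negative part. Multiplying the two expressions gives
  \<open>w \<bullet> w\<close> as minus a sum of nonnegative terms, so \<open>w = 0\<close>. Pairing
  with \<open>p\<close>, where all vectors are strictly negative, then shows that neither part has
  any term.\<close>

lemma obtuse_vectors_independent:
  fixes B :: "'a::euclidean_space set"
  assumes fin: "finite B" and obt: "\<And>a b. a \<in> B \<Longrightarrow> b \<in> B \<Longrightarrow> a \<noteq> b \<Longrightarrow> a \<bullet> b \<le> 0"
    and neg: "\<And>a. a \<in> B \<Longrightarrow> a \<bullet> p < 0"
  shows "independent B"
proof -
  have "\<forall>v\<in>B. u v = 0" if u: "(\<Sum>v\<in>B. u v *\<^sub>R v) = 0" for u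
  proof -
    define P where "P = {v\<in>B. 0 < u v}"
    define N where "N = {v\<in>B. u v < 0}"
    define w where "w = (\<Sum>v\<in>P. u v *\<^sub>R v)"
    have finPN: "finite P" "finite N" using fin by (auto simp: P_def N_def)
    have "(\<Sum>v\<in>B. u v *\<^sub>R v) = (\<Sum>v\<in>P \<union> N. u v *\<^sub>R v)"
      using fin by (intro sum.mono_neutral_right) (auto simp: P_def N_def)
    also have "\<dots> = w + (\<Sum>v\<in>N. u v *\<^sub>R v)"
      unfolding w_def using finPN by (intro sum.union_disjoint) (auto simp: P_def N_def)
    finally have wN: "w = - (\<Sum>v\<in>N. u v *\<^sub>R v)" using u by (simp add: eq_neg_iff_add_eq_0)
    have "w \<bullet> w = - (\<Sum>v\<in>P. \<Sum>v'\<in>N. u v * u v' * (v \<bullet> v'))"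
    proof -
      have "w \<bullet> w = w \<bullet> (- (\<Sum>v\<in>N. u v *\<^sub>R v))" using wN by metis
      also have "\<dots> = - (\<Sum>v\<in>P. (u v *\<^sub>R v) \<bullet> (\<Sum>v\<in>N. u v *\<^sub>R v))"
        unfolding w_def by (simp only: inner_minus_right inner_sum_left)
      finally show ?thesis by (simp add: inner_sum_right ac_simps)
    qed
    also have "\<dots> \<le> 0"
    proof -
      have "0 \<le> u v * u v' * (v \<bullet> v')" if "v \<in> P" "v' \<in> N" for v v'
        using that obt[of v v'] by (cases "v = v'") (auto simp: P_def N_def intro!: mult_nonpos_nonpos mult_nonneg_nonpos)
      then show ?thesis by (simp add: sum_nonneg)
    qed
    finally have "w = 0" by (metis inner_ge_zero inner_eq_zero_iff order_antisym)
    have "(\<Sum>v\<in>P. u v * (v \<bullet> p)) = 0"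
      using arg_cong[OF \<open>w = 0\<close>, of "\<lambda>x. x \<bullet> p"] by (simp add: w_def inner_sum_left)
    moreover have "u v * (v \<bullet> p) < 0" if "v \<in> P" for v
      using that neg by (auto simp: P_def mult_pos_neg)
    ultimately have P: "P = {}" using finPN sum_strict_mono[of P "\<lambda>v. u v * (v \<bullet> p)" "\<lambda>_. 0"] by fastforce
    have "(\<Sum>v\<in>N. u v * (v \<bullet> p)) = 0"
      using arg_cong[OF wN, of "\<lambda>x. x \<bullet> p"] \<open>w = 0\<close> by (simp add: inner_sum_left)
    moreover have "u v * (v \<bullet> p) > 0" if "v \<in> N" for v
      using that neg by (auto simp: N_def mult_neg_neg)
    ultimately have N: "N = {}" using finPN sum_strict_mono[of N "\<lambda>_. 0" "\<lambda>v. u v * (v \<bullet> p)"] by fastforce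
    show ?thesis using P N unfolding P_def N_def by force
  qed
  then show ?thesis using fin by (auto simp: independent_explicit)
qed

section \<open>Hessians on convex bodies\<close>

lemma continuous_on_eq_dense:
  fixes f g :: "'a::metric_space \<Rightarrow> 'b::metric_space"
  assumes "continuous_on S f" "continuous_on S g" "U \<subseteq> S" "S \<subseteq> closure U"
    and "\<And>y. y \<in> U \<Longrightarrow> f y = g y" and x: "x \<in> S"
  shows "f x = g x"
proof -
  obtain s where s: "\<And>n. s n \<in> U" "s \<longlonglongrightarrow> x"
    using x assms(4) closure_sequential[of x U] by blast
  then have "\<And>n. s n \<in> S" using assms(3) by blast
  then have "(\<lambda>n. f (s n)) \<longlonglongrightarrow> f x" "(\<lambda>n. g (s n)) \<longlonglongrightarrow> g x"
    using assms(1,2) s(2) x by (auto simp: continuous_on_sequentially comp_def)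
  moreover have "(\<lambda>n. f (s n)) = (\<lambda>n. g (s n))" using assms(5) s by auto
  ultimately show ?thesis by (metis LIMSEQ_unique)
qed

lemma convex_subset_closure_interior:
  fixes S :: "'a::euclidean_space set"
  assumes "convex S" "interior S \<noteq> {}"
  shows "S \<subseteq> closure (interior S)"
  using convex_closure_interior[OF assms] closure_subset[of S] by simp

text \<open>Makes the definite description in \<open>hessian\<close> usable: derivatives are unique
  in the interior, and the interior is dense in a convex body, so continuity settles the boundary
  values.\<close>

lemma hessian_eq:
  fixes S :: "(real ^ 'n) set"
  assumes S: "convex S" "interior S \<noteq> {}" and C: "C2_derivs S f g H" and x: "x \<in> S"
  shows "hessian S f x = H x"
  unfolding hessian_def
proof (rule the_equality)
  show "\<exists>g H'. C2_derivs S f g H' \<and> H' x = H x" using C by blast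
next
  fix M assume "\<exists>g H. C2_derivs S f g H \<and> H x = M"
  then obtain g' H' where C': "C2_derivs S f g' H'" "H' x = M" by blast
  have gg: "g y = g' y" if "y \<in> interior S" for y
  proof -
    have "(\<lambda>h. g y \<bullet> h) = (\<lambda>h. g' y \<bullet> h)"
      using C C'(1) that unfolding C2_derivs_def by (blast intro: has_derivative_unique)
    then show ?thesis by (metis vector_eq_rdot)
  qed
  have HH: "H y = H' y" if y: "y \<in> interior S" for y
  proof -
    have "(g has_derivative (\<lambda>h. H y *v h)) (at y)" using C y unfolding C2_derivs_def by blast
    moreover have "(g has_derivative (\<lambda>h. H' y *v h)) (at y)"
    proof (rule has_derivative_transform_within_open)
      show "(g' has_derivative (\<lambda>h. H' y *v h)) (at y)" using C' y unfolding C2_derivs_def by blast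
    qed (use y gg in auto)
    ultimately have "(\<lambda>h. H y *v h) = (\<lambda>h. H' y *v h)" by (rule has_derivative_unique)
    then show ?thesis by (metis matrix_eq)
  qed
  have "H x = H' x"
    using continuous_on_eq_dense[of S H H' "interior S" x] C C'(1) HH x interior_subset
      convex_subset_closure_interior[OF S] unfolding C2_derivs_def by blast
  then show "M = H x" using C' by simp
qed

section \<open>Symmetry of the Hessian up to the boundary\<close>

text \<open>The mean value theorem is used twice, first along \<open>h\<close> on the difference of
  \<open>f\<close> across \<open>t *\<^sub>R k\<close>, then along \<open>k\<close> on the
  directional derivative. The left-hand side is symmetric in \<open>h\<close> and \<open>k\<close>,
  which is what the next lemma exploits.\<close>

lemma mixed_difference_mvt:
  fixes S :: "(real ^ 'n) set"
  assumes C: "C2_derivs S f g H" and t: "0 < t"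
    and ball: "\<And>s r. 0 \<le> s \<Longrightarrow> s \<le> t \<Longrightarrow> 0 \<le> r \<Longrightarrow> r \<le> t \<Longrightarrow> x + s *\<^sub>R h + r *\<^sub>R k \<in> interior S"
  obtains s r where "0 < s" "s < t" "0 < r" "r < t"
    "f (x + t *\<^sub>R h + t *\<^sub>R k) - f (x + t *\<^sub>R h) - f (x + t *\<^sub>R k) + f x
       = t\<^sup>2 * (h \<bullet> (H (x + s *\<^sub>R h + r *\<^sub>R k) *v k))"
proof -
  have Df: "((\<lambda>s. f (x + s *\<^sub>R h + r *\<^sub>R k)) has_real_derivative g (x + s *\<^sub>R h + r *\<^sub>R k) \<bullet> h) (at s)"
    if "0 \<le> s" "s \<le> t" "0 \<le> r" "r \<le> t" for s r
  proof -
    have "((\<lambda>s. x + s *\<^sub>R h + r *\<^sub>R k) has_derivative (\<lambda>d. d *\<^sub>R h)) (at s)"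
      by (auto intro!: derivative_eq_intros)
    moreover have "(f has_derivative (\<lambda>v. g (x + s *\<^sub>R h + r *\<^sub>R k) \<bullet> v)) (at (x + s *\<^sub>R h + r *\<^sub>R k))"
      using C ball that unfolding C2_derivs_def by blast
    ultimately have "((\<lambda>s. f (x + s *\<^sub>R h + r *\<^sub>R k)) has_derivative
        (\<lambda>d. g (x + s *\<^sub>R h + r *\<^sub>R k) \<bullet> (d *\<^sub>R h))) (at s)"
      by (rule has_derivative_compose)
    then show ?thesis unfolding has_field_derivative_def
      by (rule has_derivative_eq_rhs) (simp add: fun_eq_iff)
  qed
  have "((\<lambda>s. f (x + s *\<^sub>R h + t *\<^sub>R k) - f (x + s *\<^sub>R h)) has_real_derivative
      g (x + s *\<^sub>R h + t *\<^sub>R k) \<bullet> h - g (x + s *\<^sub>R h) \<bullet> h) (at s)" if "0 \<le> s" "s \<le> t" for s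
    using DERIV_diff[OF Df[of s t] Df[of s 0]] that t by simp
  then obtain s where s: "0 < s" "s < t"
    "(f (x + t *\<^sub>R h + t *\<^sub>R k) - f (x + t *\<^sub>R h)) - (f (x + 0 *\<^sub>R h + t *\<^sub>R k) - f (x + 0 *\<^sub>R h))
      = (t - 0) * (g (x + s *\<^sub>R h + t *\<^sub>R k) \<bullet> h - g (x + s *\<^sub>R h) \<bullet> h)"
    using MVT2[OF t, of "\<lambda>s. f (x + s *\<^sub>R h + t *\<^sub>R k) - f (x + s *\<^sub>R h)"
        "\<lambda>s. g (x + s *\<^sub>R h + t *\<^sub>R k) \<bullet> h - g (x + s *\<^sub>R h) \<bullet> h"] by blast
  have "((\<lambda>r. h \<bullet> g (x + s *\<^sub>R h + r *\<^sub>R k)) has_real_derivative h \<bullet> (H (x + s *\<^sub>R h + r *\<^sub>R k) *v k)) (at r)"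
    if "0 \<le> r" "r \<le> t" for r
  proof -
    have "((\<lambda>r. x + s *\<^sub>R h + r *\<^sub>R k) has_derivative (\<lambda>d. d *\<^sub>R k)) (at r)"
      by (auto intro!: derivative_eq_intros)
    moreover have "(g has_derivative (\<lambda>v. H (x + s *\<^sub>R h + r *\<^sub>R k) *v v)) (at (x + s *\<^sub>R h + r *\<^sub>R k))"
      using C ball[of s r] s that unfolding C2_derivs_def by (meson less_imp_le)
    ultimately have "((\<lambda>r. g (x + s *\<^sub>R h + r *\<^sub>R k)) has_derivative
        (\<lambda>d. H (x + s *\<^sub>R h + r *\<^sub>R k) *v (d *\<^sub>R k))) (at r)"
      by (rule has_derivative_compose)
    then have "((\<lambda>r. h \<bullet> g (x + s *\<^sub>R h + r *\<^sub>R k)) has_derivative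
        (\<lambda>d. h \<bullet> (H (x + s *\<^sub>R h + r *\<^sub>R k) *v (d *\<^sub>R k)))) (at r)"
      by (rule has_derivative_inner_right)
    then show ?thesis unfolding has_field_derivative_def
      by (rule has_derivative_eq_rhs) (simp add: fun_eq_iff matrix_vector_mult_scaleR)
  qed
  then obtain r where r: "0 < r" "r < t"
    "h \<bullet> g (x + s *\<^sub>R h + t *\<^sub>R k) - h \<bullet> g (x + s *\<^sub>R h + 0 *\<^sub>R k)
      = (t - 0) * (h \<bullet> (H (x + s *\<^sub>R h + r *\<^sub>R k) *v k))"
    using MVT2[OF t, of "\<lambda>r. h \<bullet> g (x + s *\<^sub>R h + r *\<^sub>R k)"
        "\<lambda>r. h \<bullet> (H (x + s *\<^sub>R h + r *\<^sub>R k) *v k)"] by blast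
  have "f (x + t *\<^sub>R h + t *\<^sub>R k) - f (x + t *\<^sub>R h) - f (x + t *\<^sub>R k) + f x
       = t * (t * (h \<bullet> (H (x + s *\<^sub>R h + r *\<^sub>R k) *v k)))"
    using s(3) r(3) by (simp add: inner_commute)
  then show ?thesis using that[OF s(1,2) r(1,2)] by (simp add: power2_eq_square mult.assoc)
qed

lemma C2_derivs_hessian_symmetric_interior:
  fixes S :: "(real ^ 'n) set"
  assumes C: "C2_derivs S f g H" and x: "x \<in> interior S"
  shows "h \<bullet> (H x *v k) = k \<bullet> (H x *v h)"
proof (rule ccontr)
  assume ne: "h \<bullet> (H x *v k) \<noteq> k \<bullet> (H x *v h)"
  \<comment> \<open>Half the gap: two values within less than \<open>e\<close> of the two sides
    cannot coincide.\<close>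
  define e where "e = \<bar>h \<bullet> (H x *v k) - k \<bullet> (H x *v h)\<bar> / 2"
  have e: "0 < e" using ne unfolding e_def by simp
  have cH: "continuous_on (interior S) H"
    using C interior_subset unfolding C2_derivs_def by (blast intro: continuous_on_subset)
  have "continuous_on (interior S) (\<lambda>y. a \<bullet> (H y *v b))" for a b
    unfolding matrix_vector_mult_def using cH by (auto intro!: continuous_intros)
  then have "isCont (\<lambda>y. h \<bullet> (H y *v k)) x" "isCont (\<lambda>y. k \<bullet> (H y *v h)) x"
    using x by (auto simp: continuous_on_eq_continuous_at)
  then have ev: "eventually (\<lambda>y. dist (h \<bullet> (H y *v k)) (h \<bullet> (H x *v k)) < e) (nhds x)"
    "eventually (\<lambda>y. dist (k \<bullet> (H y *v h)) (k \<bullet> (H x *v h)) < e) (nhds x)"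
    using e unfolding continuous_at_eps_delta eventually_nhds_metric by auto
  have "eventually (\<lambda>y. y \<in> interior S) (nhds x)" using x by (auto simp: eventually_nhds)
  with ev have "eventually (\<lambda>y. y \<in> interior S \<and> \<bar>h \<bullet> (H y *v k) - h \<bullet> (H x *v k)\<bar> < e \<and>
      \<bar>k \<bullet> (H y *v h) - k \<bullet> (H x *v h)\<bar> < e) (nhds x)"
    by eventually_elim (auto simp: dist_real_def)
  then obtain d where d: "0 < d" and dP: "\<And>y. dist y x < d \<Longrightarrow> y \<in> interior S \<and>
      \<bar>h \<bullet> (H y *v k) - h \<bullet> (H x *v k)\<bar> < e \<and> \<bar>k \<bullet> (H y *v h) - k \<bullet> (H x *v h)\<bar> < e"
    unfolding eventually_nhds_metric by blast
  \<comment> \<open>Small enough to keep the whole parallelogram spanned by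
    \<open>t *\<^sub>R h\<close> and \<open>t *\<^sub>R k\<close> within distance \<open>d\<close>
    of \<open>x\<close>; the summand 1 keeps the denominator positive.\<close>
  define t where "t = d / (norm h + norm k + 1)"
  have t: "0 < t" unfolding t_def using d by (simp add: add_nonneg_pos)
  have td: "t * (norm h + norm k) < d"
    using d unfolding t_def by (simp add: divide_simps add_nonneg_pos)
  have near: "dist (x + s *\<^sub>R h + r *\<^sub>R k) x < d" if "0 \<le> s" "s \<le> t" "0 \<le> r" "r \<le> t" for s r
  proof -
    have "norm (s *\<^sub>R h + r *\<^sub>R k) \<le> s * norm h + r * norm k"
      using that by (intro norm_triangle_le) simp
    also have "\<dots> \<le> t * norm h + t * norm k"
      using that by (intro add_mono mult_right_mono) auto
    also have "\<dots> < d" using td by (simp add: distrib_left)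
    finally show ?thesis by (simp add: dist_norm add.assoc)
  qed
  obtain s r where sr: "0 < s" "s < t" "0 < r" "r < t"
    "f (x + t *\<^sub>R h + t *\<^sub>R k) - f (x + t *\<^sub>R h) - f (x + t *\<^sub>R k) + f x
       = t\<^sup>2 * (h \<bullet> (H (x + s *\<^sub>R h + r *\<^sub>R k) *v k))"
    using mixed_difference_mvt[OF C t, of x h k] near dP by blast
  have "x + s *\<^sub>R k + r *\<^sub>R h \<in> interior S" if "0 \<le> s" "s \<le> t" "0 \<le> r" "r \<le> t" for s r
    using near[of r s] dP that by (simp add: add.assoc add.commute[of "s *\<^sub>R k"])
  then obtain s' r' where sr': "0 < s'" "s' < t" "0 < r'" "r' < t"
    "f (x + t *\<^sub>R k + t *\<^sub>R h) - f (x + t *\<^sub>R k) - f (x + t *\<^sub>R h) + f x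
       = t\<^sup>2 * (k \<bullet> (H (x + s' *\<^sub>R k + r' *\<^sub>R h) *v h))"
    using mixed_difference_mvt[OF C t, of x k h] by blast
  let ?y = "x + s *\<^sub>R h + r *\<^sub>R k" and ?y' = "x + r' *\<^sub>R h + s' *\<^sub>R k"
  have "x + s' *\<^sub>R k + r' *\<^sub>R h = ?y'" "x + t *\<^sub>R k + t *\<^sub>R h = x + t *\<^sub>R h + t *\<^sub>R k"
    by (simp_all add: algebra_simps)
  note eqs = this
  have "t\<^sup>2 * (h \<bullet> (H ?y *v k)) = t\<^sup>2 * (k \<bullet> (H ?y' *v h))"
    using sr(5) sr'(5) unfolding eqs by linarith
  then have "h \<bullet> (H ?y *v k) = k \<bullet> (H ?y' *v h)" using t by simp
  moreover have "\<bar>h \<bullet> (H ?y *v k) - h \<bullet> (H x *v k)\<bar> < e" using dP near sr by (meson less_imp_le)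
  moreover have "\<bar>k \<bullet> (H ?y' *v h) - k \<bullet> (H x *v h)\<bar> < e" using dP near sr' by (meson less_imp_le)
  ultimately show False unfolding e_def by (simp add: abs_if split: if_splits)
qed

lemma C2_derivs_hessian_symmetric:
  fixes S :: "(real ^ 'n) set"
  assumes S: "convex S" "interior S \<noteq> {}" and C: "C2_derivs S f g H" and x: "x \<in> S"
  shows "transpose (H x) = H x"
proof -
  have eq: "transpose (H y) = H y" if "y \<in> interior S" for y
  proof -
    have "k \<bullet> (transpose (H y) *v h) = k \<bullet> (H y *v h)" for h k
      using C2_derivs_hessian_symmetric_interior[OF C that, of h k]
      by (metis dot_lmul_matrix inner_commute vector_transpose_matrix)
    then show ?thesis by (metis matrix_eq vector_eq_ldot)
  qed
  have "continuous_on S H" using C unfolding C2_derivs_def by blast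
  moreover from this have "continuous_on S (\<lambda>y. transpose (H y))"
    unfolding transpose_def by (intro continuous_intros) auto
  ultimately show ?thesis
    using continuous_on_eq_dense[of S "\<lambda>y. transpose (H y)" H "interior S" x] eq x interior_subset
      convex_subset_closure_interior[OF S] by blast
qed

section \<open>Affine changes of variable and normalisation of the Hessian\<close>

lemma affine_vimage_interior:
  fixes A :: "real ^ 'n ^ 'n"
  assumes A: "invertible A"
  shows "interior ((\<lambda>x. A *v x + b) -` S) = (\<lambda>x. A *v x + b) -` interior S"
proof
  let ?T = "\<lambda>x. A *v x + b"
  have "surj ((*v) A)" using A by (metis invertible_right_inverse matrix_right_invertible_surjective)
  then have "open ((+) b ` ((*v) A ` interior (?T -` S)))"
    by (intro open_translation open_surjective_linear_image) auto
  moreover have "(+) b ` ((*v) A ` interior (?T -` S)) = ?T ` interior (?T -` S)"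
    by (auto simp: image_image add.commute)
  moreover have "?T ` interior (?T -` S) \<subseteq> S" using interior_subset by fast
  ultimately have "?T ` interior (?T -` S) \<subseteq> interior S"
    by (metis interior_maximal)
  then show "interior (?T -` S) \<subseteq> ?T -` interior S" by blast
  have "open (?T -` interior S)"
    by (intro open_vimage) (auto intro!: continuous_intros)
  then show "?T -` interior S \<subseteq> interior (?T -` S)"
    by (intro interior_maximal) (use interior_subset in auto)
qed

lemma C2_derivs_affine_comp:
  fixes A :: "real ^ 'n ^ 'n" and b :: "real ^ 'n" and S :: "(real ^ 'n) set"
  assumes A: "invertible A" and C: "C2_derivs S f g H"
  defines "T \<equiv> \<lambda>x. A *v x + b"
  shows "C2_derivs (T -` S) (f \<circ> T) (\<lambda>x. transpose A *v g (T x)) (\<lambda>x. transpose A ** H (T x) ** A)"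
proof -
  have DT: "(T has_derivative (\<lambda>h. A *v h)) (at x)" for x
    unfolding T_def
    by (rule has_derivative_eq_rhs[OF has_derivative_add[OF bounded_linear_imp_has_derivative has_derivative_const]])
      auto
  have cT: "continuous_on X T" for X unfolding T_def by (intro continuous_intros)
  have img: "T ` (T -` S) \<subseteq> S" by auto
  have Df: "((f \<circ> T) has_derivative (\<lambda>h. (transpose A *v g (T x)) \<bullet> h)) (at x)"
    if "x \<in> interior (T -` S)" for x
  proof -
    have "T x \<in> interior S" using that affine_vimage_interior[OF A] unfolding T_def by auto
    then have "(f has_derivative (\<lambda>h. g (T x) \<bullet> h)) (at (T x))"
      using C unfolding C2_derivs_def by blast
    from has_derivative_compose[OF DT this]
    show ?thesis by (simp add: comp_def dot_lmul_matrix)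
  qed
  have Dg: "((\<lambda>x. transpose A *v g (T x)) has_derivative (\<lambda>h. (transpose A ** H (T x) ** A) *v h)) (at x)"
    if "x \<in> interior (T -` S)" for x
  proof -
    have "T x \<in> interior S" using that affine_vimage_interior[OF A] unfolding T_def by auto
    then have "(g has_derivative (\<lambda>h. H (T x) *v h)) (at (T x))"
      using C unfolding C2_derivs_def by blast
    from has_derivative_compose[OF DT this]
    have "((\<lambda>x. g (T x)) has_derivative (\<lambda>h. H (T x) *v (A *v h))) (at x)" .
    from bounded_linear.has_derivative[OF matrix_vector_mul_bounded_linear this, of "transpose A"]
    show ?thesis by (simp add: matrix_vector_mul_assoc matrix_mul_assoc)
  qed
  have "continuous_on (T -` S) (\<lambda>x. g (T x))" "continuous_on (T -` S) (\<lambda>x. H (T x))"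
    "continuous_on (T -` S) (\<lambda>x. f (T x))"
    using C cT img unfolding C2_derivs_def by (blast intro: continuous_on_compose2)+
  then have "continuous_on (T -` S) (f \<circ> T)" "continuous_on (T -` S) (\<lambda>x. transpose A *v g (T x))"
    "continuous_on (T -` S) (\<lambda>x. transpose A ** H (T x) ** A)"
    by (auto simp: comp_def matrix_matrix_mult_def matrix_vector_mult_def intro!: continuous_intros)
  then show ?thesis unfolding C2_derivs_def using Df Dg by blast
qed

text \<open>Gram-Schmidt for the inner product \<open>x \<bullet> (H *v y)\<close>: the columns of
  \<open>A\<close> form a basis orthonormal for it.\<close>

lemma posdef_congruent_identity:
  fixes H :: "real ^ 'n ^ 'n"
  assumes sym: "transpose H = H" and pos: "\<And>x. x \<noteq> 0 \<Longrightarrow> 0 < x \<bullet> (H *v x)"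
  obtains A :: "real ^ 'n ^ 'n" where "invertible A" "transpose A ** H ** A = mat 1"
proof -
  have symm: "x \<bullet> (H *v y) = y \<bullet> (H *v x)" for x y
    using sym by (metis dot_lmul_matrix inner_commute vector_transpose_matrix)
  have ex: "\<exists>B. finite B \<and> card B = k \<and> (\<forall>a\<in>B. a \<bullet> (H *v a) = 1) \<and> (\<forall>a\<in>B. \<forall>b\<in>B. a \<noteq> b \<longrightarrow> a \<bullet> (H *v b) = 0)"
    if "k \<le> CARD('n)" for k
    using that
  proof (induction k)
    case 0
    then show ?case by (intro exI[of _ "{}"]) auto
  next
    case (Suc k)
    then obtain B where B: "finite B" "card B = k" "\<And>a. a \<in> B \<Longrightarrow> a \<bullet> (H *v a) = 1"
      "\<And>a b. a \<in> B \<Longrightarrow> b \<in> B \<Longrightarrow> a \<noteq> b \<Longrightarrow> a \<bullet> (H *v b) = 0" by auto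
    have "dim B < dim (UNIV :: (real ^ 'n) set)"
      using dim_le_card'[of B] B Suc.prems by simp
    then have "span B \<noteq> UNIV" by (metis dim_span less_irrefl)
    then obtain x where x: "x \<notin> span B" by blast
    \<comment> \<open>The Gram-Schmidt remainder of a vector outside the span, still to be
      normalised to \<open>z\<close>.\<close>
    define y where "y = x - (\<Sum>b\<in>B. (x \<bullet> (H *v b)) *\<^sub>R b)"
    have "(\<Sum>b\<in>B. (x \<bullet> (H *v b)) *\<^sub>R b) \<in> span B"
      by (intro span_sum span_mul span_base)
    then have "y \<noteq> 0" using x unfolding y_def by auto
    have yb: "y \<bullet> (H *v b) = 0" if "b \<in> B" for b
    proof -
      have "(\<Sum>c\<in>B. (x \<bullet> (H *v c)) * (c \<bullet> (H *v b))) = (\<Sum>c\<in>B. if c = b then x \<bullet> (H *v b) else 0)"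
        using B that by (intro sum.cong) auto
      also have "\<dots> = x \<bullet> (H *v b)" using B that by simp
      finally show ?thesis unfolding y_def by (simp add: inner_diff_left inner_sum_left)
    qed
    define z where "z = (1 / sqrt (y \<bullet> (H *v y))) *\<^sub>R y"
    have "0 < y \<bullet> (H *v y)" using pos \<open>y \<noteq> 0\<close> by blast
    then have zz: "z \<bullet> (H *v z) = 1"
      unfolding z_def by (simp add: matrix_vector_mult_scaleR flip: power2_eq_square)
    have zb: "z \<bullet> (H *v b) = 0" "b \<bullet> (H *v z) = 0" if "b \<in> B" for b
      using yb[OF that] symm[of b z] unfolding z_def by auto
    have "z \<notin> B" using zz zb by force
    then show ?case
      using B zz zb by (intro exI[of _ "insert z B"]) auto
  qed
  from ex[OF order_refl] obtain B where B: "finite B" "card B = CARD('n)"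
      "\<forall>a\<in>B. a \<bullet> (H *v a) = 1" "\<forall>a\<in>B. \<forall>b\<in>B. a \<noteq> b \<longrightarrow> a \<bullet> (H *v b) = 0"
    by (elim exE conjE)
  obtain f :: "'n \<Rightarrow> real ^ 'n" where f: "bij_betw f UNIV B"
    using B finite_same_card_bij[of "UNIV :: 'n set" B] by auto
  define A where "A = transpose (\<chi> i. f i)"
  have "(transpose A ** H ** A) $ i $ j = f i \<bullet> (H *v f j)" for i j
  proof -
    have "(transpose A ** H ** A) $ i $ j = (transpose A ** (H ** A)) $ i $ j"
      by (simp add: matrix_mul_assoc)
    also have "\<dots> = row i (transpose A) \<bullet> column j (H ** A)"
      by (simp add: matrix_matrix_mult_def row_def column_def inner_vec_def)
    also have "row i (transpose A) = f i"
      unfolding A_def by (simp add: row_def)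
    also have "column j (H ** A) = H *v column j A" 
      by (simp add: vec_eq_iff column_def matrix_matrix_mult_def matrix_vector_mult_def)
    also have "column j A = f j" unfolding A_def by (simp add: row_def)
    finally show ?thesis .
  qed
  moreover have "f i \<bullet> (H *v f j) = (if i = j then 1 else 0)" for i j
    using B(3,4) f by (auto simp: bij_betw_def inj_eq)
  ultimately have I: "transpose A ** H ** A = mat 1" by (simp add: vec_eq_iff mat_def)
  then have "invertible A" by (metis invertible_left_inverse)
  then show ?thesis using I that by blast
qed

lemma tangent_cone_affine_vimage:
  fixes A :: "real ^ 'n ^ 'n"
  assumes A: "invertible A"
  shows "tangent_cone ((\<lambda>x. A *v x + b) -` S) p = {v. A *v v \<in> tangent_cone S (A *v p + b)}"
proof -
  obtain B where B: "A ** B = mat 1" "B ** A = mat 1" using A unfolding invertible_def by blast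
  have "v \<in> tangent_cone ((\<lambda>x. A *v x + b) -` S) p" if "A *v v \<in> tangent_cone S (A *v p + b)" for v
  proof -
    obtain t w where tw: "0 \<le> t" "w \<in> S" "A *v v = t *\<^sub>R (w - (A *v p + b))"
      using \<open>A *v v \<in> _\<close> unfolding tangent_cone_def by auto
    define y where "y = B *v (w - b)"
    have "A *v y + b = w" unfolding y_def by (simp add: matrix_vector_mul_assoc B)
    moreover have "v = B *v (A *v v)" by (simp add: matrix_vector_mul_assoc B)
    then have "v = t *\<^sub>R (B *v (w - b) - B *v (A *v p))"
      unfolding tw(3) by (simp add: matrix_vector_mult_scaleR matrix_vector_mult_diff_distrib diff_diff_eq2 diff_diff_eq add.commute flip: matrix_vector_mult_diff_distrib)
    then have "v = t *\<^sub>R (y - p)" unfolding y_def by (simp add: matrix_vector_mul_assoc B)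
    ultimately show ?thesis unfolding tangent_cone_def using tw by auto
  qed
  moreover have "A *v v \<in> tangent_cone S (A *v p + b)"
    if v: "v \<in> tangent_cone ((\<lambda>x. A *v x + b) -` S) p" for v
  proof -
    obtain t y where ty: "0 \<le> t" "A *v y + b \<in> S" "v = t *\<^sub>R (y - p)"
      using v unfolding tangent_cone_def by auto
    have "A *v v = t *\<^sub>R ((A *v y + b) - (A *v p + b))"
      unfolding ty(3) by (simp add: matrix_vector_mult_scaleR matrix_vector_mult_diff_distrib)
    then show ?thesis unfolding tangent_cone_def using ty by blast
  qed
  ultimately show ?thesis by blast
qed

lemma uniformly_convexE:
  fixes S :: "(real ^ 'n) set"
  assumes S: "convex S" "interior S \<noteq> {}" and u: "uniformly_convex S u" and x: "x \<in> S"
  shows "transpose (hessian S u x) = hessian S u x"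
    and "v \<noteq> 0 \<Longrightarrow> 0 < v \<bullet> (hessian S u x *v v)"
proof -
  obtain g H where C: "C2_derivs S u g H" using u unfolding uniformly_convex_def C2_on_def by blast
  show "transpose (hessian S u x) = hessian S u x"
    using hessian_eq[OF S C x] C2_derivs_hessian_symmetric[OF S C x] by simp
  obtain c where c: "c > 0" "\<And>v. c * (norm v)\<^sup>2 \<le> v \<bullet> (hessian S u x *v v)"
    using u x unfolding uniformly_convex_def by auto
  show "0 < v \<bullet> (hessian S u x *v v)" if "v \<noteq> 0"
    using c(2)[of v] c(1) that by (smt (verit) mult_pos_pos zero_less_norm_iff zero_less_power)
qed

text \<open>\<open>Theta\<close> picks its transformation by \<open>SOME\<close>, so only the
  defining property of that choice is available. The translation part disappears because the tangent
  cone is pulled back by the linear part alone; later proofs see only a matrix \<open>A\<close> with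
  the normalising equation.\<close>

lemma Theta_normalised:
  fixes \<Omega> :: "(real ^ 'n) set"
  assumes S: "convex \<Omega>" "interior \<Omega> \<noteq> {}" and u: "uniformly_convex \<Omega> u" and x: "x \<in> \<Omega>"
  obtains A :: "real ^ 'n ^ 'n" where "invertible A" "transpose A ** hessian \<Omega> u x ** A = mat 1"
    "Theta u x \<Omega> = Max {dihedral_angle {v. A *v v \<in> tangent_cone \<Omega> x} F G | F G.
       adjacent_facets {v. A *v v \<in> tangent_cone \<Omega> x} F G}"
proof -
  obtain g H where C: "C2_derivs \<Omega> u g H" using u unfolding uniformly_convex_def C2_on_def by blast
  have pull: "hessian (T -` \<Omega>) (u \<circ> T) (inv T x) = transpose A ** hessian \<Omega> u x ** A
      \<and> T (inv T x) = x"
    if A: "invertible A" and T: "T = (\<lambda>x. A *v x + b)"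
    for A :: "real ^ 'n ^ 'n" and T b
  proof -
    obtain B where B: "A ** B = mat 1" using A unfolding invertible_def by blast
    have "T (B *v (y - b)) = y" for y unfolding T by (simp add: matrix_vector_mul_assoc B)
    then have surj: "surj T" using surjI[of T "\<lambda>y. B *v (y - b)"] by blast
    then have Tx: "T (inv T x) = x" by (simp add: surj_f_inv_f)
    have "convex (T -` \<Omega>)"
    proof -
      have "T -` \<Omega> = (*v) A -` ((\<lambda>y. y - b) ` \<Omega>)"
        unfolding T by (auto simp: image_iff) (metis add_diff_cancel)
      then show ?thesis
        using S(1) by (simp add: convex_linear_vimage convex_translation_subtract)
    qed
    moreover have "interior (T -` \<Omega>) \<noteq> {}"
      using affine_vimage_interior[OF A] S(2) surj unfolding T by (metis surj_vimage_empty)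
    ultimately have "hessian (T -` \<Omega>) (u \<circ> T) (inv T x) = transpose A ** H (T (inv T x)) ** A"
      using hessian_eq[OF _ _ C2_derivs_affine_comp[OF A C, of b]] x Tx unfolding T by auto
    then show ?thesis using hessian_eq[OF S C x] Tx by simp
  qed
  define P where "P = (\<lambda>T. affine_transformation T \<and> hessian (T -` \<Omega>) (u \<circ> T) (inv T x) = mat 1)"
  obtain A0 :: "real ^ 'n ^ 'n" where A0: "invertible A0" "transpose A0 ** hessian \<Omega> u x ** A0 = mat 1"
    by (rule posdef_congruent_identity[OF uniformly_convexE(1,2)[OF S u x]])
  have "affine_transformation (\<lambda>y. A0 *v y + 0)"
    unfolding affine_transformation_def using A0(1) by blast
  then have "P (\<lambda>y. A0 *v y + 0)"
    unfolding P_def using pull[OF A0(1) refl, of 0] A0(2) by simp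
  then have "P (SOME T. P T)" by (rule someI[of P])
  then obtain A b where A: "invertible A" "(SOME T. P T) = (\<lambda>x. A *v x + b)"
    and hess: "hessian ((SOME T. P T) -` \<Omega>) (u \<circ> (SOME T. P T)) (inv (SOME T. P T) x) = mat 1"
    unfolding P_def affine_transformation_def by blast
  note pull = pull[OF A]
  have "transpose A ** hessian \<Omega> u x ** A = mat 1" using hess pull by simp
  moreover have "tangent_cone ((SOME T. P T) -` \<Omega>) (inv (SOME T. P T) x) = {v. A *v v \<in> tangent_cone \<Omega> x}"
    using pull unfolding A(2) by (simp add: tangent_cone_affine_vimage[OF A(1)])
  ultimately show ?thesis
    using that[OF A(1)] unfolding Theta_def P_def[symmetric] Let_def by simp
qed

section \<open>Tangent cones\<close>

lemma halfspaces_polyhedron: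
  fixes d :: "'i \<Rightarrow> 'a::euclidean_space"
  assumes "finite J"
  shows "polyhedron {v. \<forall>i\<in>J. d i \<bullet> v \<le> c i}"
proof -
  have "{v. \<forall>i\<in>J. d i \<bullet> v \<le> c i} = \<Inter>((\<lambda>i. {v. d i \<bullet> v \<le> c i}) ` J)" by auto
  then show ?thesis
    using assms by (auto intro!: polyhedron_Inter polyhedron_halfspace_le simp del: INT_simps)
qed

text \<open>A constraint that is not tight at \<open>x\<close> has slack and survives a short step
  along \<open>v\<close>. There are finitely many, so one \<open>t > 0\<close> serves all of them,
  and \<open>v\<close> is \<open>1 / t\<close> times the difference of two points of the
  set.\<close>

lemma tangent_cone_halfspaces:
  fixes n :: "'i \<Rightarrow> real ^ 'n"
  assumes "finite I" and x: "\<forall>i\<in>I. n i \<bullet> x \<le> c i"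
  shows "tangent_cone {y. \<forall>i\<in>I. n i \<bullet> y \<le> c i} x = {v. \<forall>i\<in>{i\<in>I. n i \<bullet> x = c i}. n i \<bullet> v \<le> 0}"
    (is "tangent_cone ?S x = ?V")
proof
  show "tangent_cone ?S x \<subseteq> ?V"
    unfolding tangent_cone_def by (auto simp: inner_diff_right mult_nonneg_nonpos)
  show "?V \<subseteq> tangent_cone ?S x"
  proof
    fix v assume v: "v \<in> ?V"
    have "\<forall>\<^sub>F t in at_right 0. n i \<bullet> (x + t *\<^sub>R v) \<le> c i" if i: "i \<in> I" for i
    proof (cases "n i \<bullet> x = c i")
      case True
      then have "n i \<bullet> v \<le> 0" using v i by auto
      then have "n i \<bullet> (x + t *\<^sub>R v) \<le> c i" if "0 < t" for t
        using that True by (simp add: inner_add_right mult_nonneg_nonpos)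
      then show ?thesis by (auto simp: eventually_at_filter)
    next
      case False
      then have "n i \<bullet> (x + 0 *\<^sub>R v) < c i" using x i by (simp add: order_less_le)
      moreover have "((\<lambda>t. n i \<bullet> (x + t *\<^sub>R v)) \<longlongrightarrow> n i \<bullet> (x + 0 *\<^sub>R v)) (at_right 0)"
        by (intro tendsto_intros)
      ultimately have "\<forall>\<^sub>F t in at_right 0. n i \<bullet> (x + t *\<^sub>R v) < c i"
        by (auto dest: order_tendstoD)
      then show ?thesis by eventually_elim simp
    qed
    then have "\<forall>\<^sub>F t in at_right 0. \<forall>i\<in>I. n i \<bullet> (x + t *\<^sub>R v) \<le> c i"
      using assms(1) by (simp add: eventually_ball_finite_distrib)
    moreover have "\<forall>\<^sub>F t in at_right (0::real). 0 < t" by (simp add: eventually_at_filter)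
    ultimately have "\<forall>\<^sub>F t in at_right 0. (\<forall>i\<in>I. n i \<bullet> (x + t *\<^sub>R v) \<le> c i) \<and> 0 < t"
      by eventually_elim simp
    then obtain t where t: "\<forall>i\<in>I. n i \<bullet> (x + t *\<^sub>R v) \<le> c i" "0 < t"
      using eventually_happens'[OF trivial_limit_at_right_real] by blast
    then have "v = (1 / t) *\<^sub>R ((x + t *\<^sub>R v) - x)" "x + t *\<^sub>R v \<in> ?S" by auto
    then show "v \<in> tangent_cone ?S x" unfolding tangent_cone_def using t(2)
      by (metis (mono_tags, lifting) less_imp_le mem_Collect_eq zero_le_divide_1_iff)
  qed
qed

text \<open>Scaling a point of \<open>F\<close> by 0 and by 2 stays in the cone and forces the
  supporting constant to be 0.\<close>

lemma conic_outer_normal: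
  fixes V :: "(real ^ 'n) set"
  assumes V: "polyhedron V" "interior V \<noteq> {}"
    and con: "\<And>v t. v \<in> V \<Longrightarrow> 0 \<le> t \<Longrightarrow> t *\<^sub>R v \<in> V" and F: "F facet_of V"
  shows "norm (outer_normal V F) = 1 \<and> (\<forall>x\<in>V. outer_normal V F \<bullet> x \<le> 0)
    \<and> F = V \<inter> {x. outer_normal V F \<bullet> x = 0}"
proof -
  obtain c where c: "\<forall>x\<in>V. outer_normal V F \<bullet> x \<le> c" "F = V \<inter> {x. outer_normal V F \<bullet> x = c}"
    using outer_normal_props(2)[OF V F] by blast
  obtain x where x: "x \<in> F" using F unfolding facet_of_def by auto
  have "x \<in> V" using x c(2) by blast
  then have "0 *\<^sub>R x \<in> V" "2 *\<^sub>R x \<in> V" by (intro con; simp)+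
  then have "0 \<le> c" "2 * c \<le> c" using c x by (fastforce, metis (mono_tags, lifting) IntD2 inner_scaleR_right mem_Collect_eq)
  then have "c = 0" by simp
  then show ?thesis using c outer_normal_props(1)[OF V F] by simp
qed

lemma dihedral_nonobtuse_iff:
  fixes V :: "(real ^ 'n) set"
  assumes "norm (outer_normal V F) = 1" "norm (outer_normal V G) = 1"
  shows "dihedral_angle V F G \<le> pi / 2 \<longleftrightarrow> outer_normal V F \<bullet> outer_normal V G \<le> 0"
proof -
  let ?t = "outer_normal V F \<bullet> outer_normal V G"
  have "\<bar>?t\<bar> \<le> 1" using Cauchy_Schwarz_ineq2[of "outer_normal V F" "outer_normal V G"] assms by simp
  then have t: "-1 \<le> ?t" "?t \<le> 1" by (simp_all add: abs_le_iff)
  have "arccos ?t < pi / 2" if "0 < ?t"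
    using arccos_less_arccos[of 0 ?t] that t by simp
  moreover have "pi / 2 \<le> arccos ?t" if "?t \<le> 0"
    using arccos_le_arccos[of ?t 0] that t by simp
  ultimately show ?thesis unfolding dihedral_angle_def by (auto simp: not_le[symmetric])
qed

lemma finite_dihedral_angles:
  fixes V :: "(real ^ 'n) set"
  assumes "polyhedron V"
  shows "finite {dihedral_angle V F G | F G. adjacent_facets V F G}"
proof (rule finite_subset)
  show "{dihedral_angle V F G | F G. adjacent_facets V F G} \<subseteq>
      (\<lambda>(F, G). dihedral_angle V F G) ` ({F. F facet_of V} \<times> {F. F facet_of V})"
    unfolding adjacent_facets_def by auto
qed (use finite_polyhedron_facets[OF assms] in simp)

lemma nonobtuse_cone_simplicial:
  fixes V :: "(real ^ 'n) set"
  assumes V: "polyhedron V" "interior V \<noteq> {}"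
    and con: "\<And>v t. v \<in> V \<Longrightarrow> 0 \<le> t \<Longrightarrow> t *\<^sub>R v \<in> V"
    and pointed: "\<And>v. v \<in> V \<Longrightarrow> - v \<in> V \<Longrightarrow> v = 0"
    and ang: "\<And>F G. adjacent_facets V F G \<Longrightarrow> dihedral_angle V F G \<le> pi / 2"
  obtains M :: "real ^ 'n ^ 'n" where "invertible M" "(*v) M ` V = {y. \<forall>i. 0 \<le> y $ i}"
proof -
  define n where "n = outer_normal V"
  have n: "norm (n F) = 1 \<and> (\<forall>x\<in>V. n F \<bullet> x \<le> 0) \<and> F = V \<inter> {x. n F \<bullet> x = 0}"
    if "F facet_of V" for F
    unfolding n_def using conic_outer_normal[OF V con that] .
  have adj: "n F \<bullet> n G \<le> 0" if "adjacent_facets V F G" for F G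
  proof -
    have "F facet_of V" "G facet_of V" using that unfolding adjacent_facets_def by auto
    then show ?thesis
      using ang[OF that] dihedral_nonobtuse_iff[of V F G] n unfolding n_def by auto
  qed
  define B where "B = n ` {F. F facet_of V}"
  have finB: "finite B" unfolding B_def using finite_polyhedron_facets[OF V(1)] by simp
  have Veq: "V = {x. \<forall>b\<in>B. b \<bullet> x \<le> 0}"
    using polyhedron_eq_facet_halfspaces[OF V, of n "\<lambda>_. 0"] n unfolding B_def by auto
  obtain p where p: "p \<in> interior V" using V by blast
  have hull: "affine hull V = UNIV"
    using V aff_dim_eq_full[of V] by (simp add: aff_dim_nonempty_interior)
  have neg: "b \<bullet> p < 0" if "b \<in> B" for b
  proof -
    obtain F where F: "F facet_of V" "b = n F" using \<open>b \<in> B\<close> unfolding B_def by auto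
    have "p \<notin> F"
      using F p rel_boundary_of_polyhedron[OF V(1)] rel_interior_interior[OF hull] by blast
    then show ?thesis using n[OF F(1)] F p interior_subset by (force simp: order_less_le)
  qed
  have "a \<bullet> b \<le> 0" if "a \<in> B" "b \<in> B" "a \<noteq> b" for a b
    using that nonobtuse_all_facets[OF V n adj] unfolding B_def by force
  then have ind: "independent B"
    using obtuse_vectors_independent[OF finB _ neg] by blast
  \<comment> \<open>A vector orthogonal to all normals lies in \<open>V\<close> together with its
    negative. So pointedness says exactly that the normals span, and being independent they form a
    basis.\<close>
  have perp: "x = 0" if "\<And>b. b \<in> B \<Longrightarrow> b \<bullet> x = 0" for x
    using pointed[of x] that unfolding Veq by simp
  have "span B = UNIV"
  proof (rule ccontr)
    assume "span B \<noteq> UNIV"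
    then obtain a where "a \<noteq> 0" "\<forall>x\<in>span B. a \<bullet> x = 0" using span_not_UNIV_orthogonal by blast
    then show False using perp[of a] span_base by (metis inner_commute)
  qed
  then have "card B = CARD('n)"
    using dim_eq_card_independent[OF ind] dim_span[of B] by simp
  then obtain f :: "'n \<Rightarrow> real ^ 'n" where f: "bij_betw f UNIV B"
    using finB finite_same_card_bij[of "UNIV :: 'n set" B] by auto
  \<comment> \<open>The sign turns nonpositive pairings with outer normals into nonnegative
    coordinates.\<close>
  define M :: "real ^ 'n ^ 'n" where "M = (\<chi> i. - f i)"
  have Mx: "(M *v x) $ i = - (f i \<bullet> x)" for x i
    unfolding M_def by (simp add: matrix_vector_mult_def inner_vec_def sum_negf)
  have fB: "B = range f" using f by (simp add: bij_betw_def)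
  have "x = 0" if "M *v x = 0" for x
    using perp[of x] Mx[of x] that unfolding fB by auto
  then have inv: "invertible M"
    by (metis invertible_left_inverse matrix_left_invertible_ker)
  then obtain N where N: "M ** N = mat 1" unfolding invertible_def by blast
  have VM: "V = {x. \<forall>i. 0 \<le> (M *v x) $ i}" unfolding Veq fB by (auto simp: Mx)
  have "y \<in> (*v) M ` V" if "\<forall>i. 0 \<le> y $ i" for y
    using that by (intro image_eqI[of _ _ "N *v y"]) (simp_all add: VM matrix_vector_mul_assoc N)
  then have "(*v) M ` V = {y. \<forall>i. 0 \<le> y $ i}" unfolding VM by blast
  then show ?thesis using that inv by blast
qed

section \<open>Polytopes with chosen facet normals; the A-condition forces simplicity\<close>

locale facet_normals =
  fixes \<Omega> :: "(real ^ 'n) set" and n :: "(real ^ 'n) set \<Rightarrow> real ^ 'n" and c :: "(real ^ 'n) set \<Rightarrow> real"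
  assumes polytope: "polytope \<Omega>" and int: "interior \<Omega> \<noteq> {}"
    and normals: "\<And>F. F facet_of \<Omega> \<Longrightarrow> norm (n F) = 1 \<and> (\<forall>x\<in>\<Omega>. n F \<bullet> x \<le> c F) \<and> F = \<Omega> \<inter> {x. n F \<bullet> x = c F}"
begin

lemma polyhedron_Omega: "polyhedron \<Omega>"
  using polytope by (rule polytope_imp_polyhedron)

lemma convex_Omega: "convex \<Omega>"
  using polyhedron_Omega by (rule polyhedron_imp_convex)

lemma finite_facets: "finite {F. F facet_of \<Omega>}"
  using polyhedron_Omega by (rule finite_polyhedron_facets)

lemma halfspaces: "\<Omega> = {x. \<forall>F\<in>{F. F facet_of \<Omega>}. n F \<bullet> x \<le> c F}"
  using polyhedron_eq_facet_halfspaces[OF polyhedron_Omega int] normals by auto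

lemma mem_facet_iff: "F facet_of \<Omega> \<Longrightarrow> x \<in> \<Omega> \<Longrightarrow> x \<in> F \<longleftrightarrow> n F \<bullet> x = c F"
  using normals by blast

definition active :: "real ^ 'n \<Rightarrow> (real ^ 'n) set set" where
  "active x = {F. F facet_of \<Omega> \<and> n F \<bullet> x = c F}"

lemma finite_active: "finite (active x)"
  using finite_facets unfolding active_def by (rule rev_finite_subset) auto

lemma tangent_cone_eq:
  assumes "x \<in> \<Omega>"
  shows "tangent_cone \<Omega> x = {v. \<forall>F\<in>active x. n F \<bullet> v \<le> 0}"
proof -
  have "tangent_cone {x. \<forall>F\<in>{F. F facet_of \<Omega>}. n F \<bullet> x \<le> c F} x =
    {v. \<forall>F\<in>{F \<in> {F. F facet_of \<Omega>}. n F \<bullet> x = c F}. n F \<bullet> v \<le> 0}"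
    using assms normals by (intro tangent_cone_halfspaces finite_facets) auto
  then show ?thesis unfolding halfspaces[symmetric] active_def by simp
qed

lemma interior_tangent_cone:
  assumes "x \<in> \<Omega>"
  shows "interior (tangent_cone \<Omega> x) \<noteq> {}"
proof -
  have "(\<lambda>y. y - x) ` \<Omega> \<subseteq> tangent_cone \<Omega> x"
    unfolding tangent_cone_def by (auto intro: exI[of _ 1])
  then have "interior ((\<lambda>y. y - x) ` \<Omega>) \<subseteq> interior (tangent_cone \<Omega> x)" by (rule interior_mono)
  moreover have "interior ((\<lambda>y. y - x) ` \<Omega>) = (\<lambda>y. y - x) ` interior \<Omega>"
    by (rule interior_translation_subtract)
  ultimately show ?thesis using int by auto
qed

lemma linear_vimage_tangent_cone:
  fixes A :: "real ^ 'n ^ 'n"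
  assumes A: "invertible A" and x: "x \<in> \<Omega>"
  shows "{v. A *v v \<in> tangent_cone \<Omega> x} = {v. \<forall>F\<in>active x. (transpose A *v n F) \<bullet> v \<le> 0}" (is "?V = _")
    and "interior {v. A *v v \<in> tangent_cone \<Omega> x} \<noteq> {}"
    and "polyhedron {v. A *v v \<in> tangent_cone \<Omega> x}"
proof -
  show eq: "?V = {v. \<forall>F\<in>active x. (transpose A *v n F) \<bullet> v \<le> 0}"
    unfolding tangent_cone_eq[OF x] by (simp add: dot_lmul_matrix)
  show "polyhedron ?V"
    unfolding eq using halfspaces_polyhedron[OF finite_active, where d = "\<lambda>F. transpose A *v n F" and c = "\<lambda>_. 0"] by simp
  have "interior ?V = (\<lambda>v. A *v v + 0) -` interior (tangent_cone \<Omega> x)"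
    using affine_vimage_interior[OF A, of 0 "tangent_cone \<Omega> x"] by (simp add: vimage_def)
  moreover have "surj (\<lambda>v. A *v v + 0)"
    using A by (simp add: invertible_right_inverse matrix_right_invertible_surjective)
  ultimately show "interior ?V \<noteq> {}"
    using interior_tangent_cone[OF x] by (metis surj_vimage_empty)
qed

lemma A_condition_imp_orthant:
  assumes card: "CARD('n) \<ge> 2" and A: "A_condition u \<Omega>" and x: "x extreme_point_of \<Omega>"
  shows "\<exists>T. affine_transformation T \<and> T ` tangent_cone \<Omega> x = {y. \<forall>i. 0 \<le> y $ i}"
proof -
  have xO: "x \<in> \<Omega>" using x unfolding extreme_point_of_def by simp
  have "{x} face_of \<Omega>" using x by (simp add: face_of_singleton)
  then have "x \<in> skeleton (CARD('n) - 2) \<Omega>" unfolding skeleton_def by (intro UnionI[of "{x}"]) auto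
  then have "A_condition_at u x \<Omega>" using A unfolding A_condition_def by blast
  then have u: "uniformly_convex \<Omega> u" and Th: "Theta u x \<Omega> \<le> pi / 2" unfolding A_condition_at_def by auto
  obtain A :: "real ^ 'n ^ 'n" where A: "invertible A"
    and TA: "Theta u x \<Omega> = Max {dihedral_angle {v. A *v v \<in> tangent_cone \<Omega> x} F G | F G.
       adjacent_facets {v. A *v v \<in> tangent_cone \<Omega> x} F G}"
    by (rule Theta_normalised[OF convex_Omega int u xO])
  define V where "V = {v. A *v v \<in> tangent_cone \<Omega> x}"
  note V = linear_vimage_tangent_cone[OF A xO, folded V_def]
  have con: "t *\<^sub>R v \<in> V" if "v \<in> V" "0 \<le> t" for v t
    using that unfolding V(1) by (simp add: mult_nonneg_nonpos)
  \<comment> \<open>If \<open>w\<close> and \<open>- w\<close> both point from \<open>x\<close> into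
    the polytope, then \<open>x\<close> is a proper convex combination of two points of it, which an
    extreme point is not.\<close>
  have pointed: "v = 0" if v: "v \<in> V" "- v \<in> V" for v
  proof -
    define w where "w = A *v v"
    have "w \<in> tangent_cone \<Omega> x" "- w \<in> tangent_cone \<Omega> x"
      using v by (simp_all add: V_def w_def linear_neg[OF matrix_vector_mul_linear])
    then obtain s t y z where st: "0 \<le> t" "0 \<le> s" "y \<in> \<Omega>" "z \<in> \<Omega>" "w = t *\<^sub>R (y - x)" "- w = s *\<^sub>R (z - x)"
      unfolding tangent_cone_def by blast
    have "w = 0"
    proof (rule ccontr)
      assume "w \<noteq> 0"
      then have "t \<noteq> 0" "s \<noteq> 0" "y \<noteq> x" using st by auto
      then have pos: "0 < t" "0 < s" using st by auto
      have "t *\<^sub>R (y - x) + s *\<^sub>R (z - x) = 0" using st by (metis add.right_inverse)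
      then have "(t + s) *\<^sub>R x = t *\<^sub>R y + s *\<^sub>R z" by (simp add: algebra_simps)
      moreover have "x = (1 / (t + s)) *\<^sub>R ((t + s) *\<^sub>R x)" using pos by simp
      ultimately have xeq: "x = (1 - s / (t + s)) *\<^sub>R y + (s / (t + s)) *\<^sub>R z"
        using pos by (simp add: scaleR_add_right divide_simps)
      have "y \<noteq> z" using xeq \<open>y \<noteq> x\<close> by (auto simp flip: scaleR_add_left)
      then have "x \<in> open_segment y z"
        unfolding in_segment using xeq pos by (intro conjI exI[of _ "s / (t + s)"]) auto
      then show False using x st unfolding extreme_point_of_def by blast
    qed
    moreover obtain B where "B ** A = mat 1" using A unfolding invertible_def by blast
    then have "v = B *v w" unfolding w_def by (simp add: matrix_vector_mul_assoc)
    ultimately show ?thesis by simp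
  qed
  have "dihedral_angle V F G \<le> pi / 2" if "adjacent_facets V F G" for F G
  proof -
    note finite_dihedral_angles[OF V(3)]
    then have "dihedral_angle V F G \<le> Theta u x \<Omega>"
      unfolding TA V_def[symmetric] using that by (intro Max_ge) auto
    then show ?thesis using Th by linarith
  qed
  then obtain M :: "real ^ 'n ^ 'n" where M: "invertible M" "(*v) M ` V = {y. \<forall>i. 0 \<le> y $ i}"
    using nonobtuse_cone_simplicial[OF V(3,2) con pointed] by blast
  obtain B where B: "A ** B = mat 1" "B ** A = mat 1" using A unfolding invertible_def by blast
  have "(*v) B ` tangent_cone \<Omega> x = V"
  proof -
    have "v = B *v (A *v v)" for v by (simp add: matrix_vector_mul_assoc B)
    moreover have "A *v (B *v v) = v" for v by (simp add: matrix_vector_mul_assoc B)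
    ultimately show ?thesis unfolding V_def by (force simp: image_iff)
  qed
  then have "(\<lambda>v. (M ** B) *v v + 0) ` tangent_cone \<Omega> x = {y. \<forall>i. 0 \<le> y $ i}"
    using M(2) by (simp add: image_image flip: matrix_vector_mul_assoc) (metis image_image)
  moreover have "invertible B" using B unfolding invertible_def by blast
  then have "affine_transformation (\<lambda>v. (M ** B) *v v + 0)"
    unfolding affine_transformation_def using M(1) invertible_mult by blast
  ultimately show ?thesis by blast
qed

end

section \<open>Potentials concentrated near ridges\<close>

text \<open>Away from 0 the function is locally a polynomial. At 0 the difference quotient in
  \<open>h\<close> is \<open>(max 0 h) ^ (k + 1)\<close> itself, which tends to 0; an exponent of at
  least 2 is what makes this work.\<close>

lemma DERIV_max0_power:
  "((\<lambda>p::real. (max 0 p) ^ (k + 2)) has_real_derivative real (k + 2) * (max 0 p) ^ (k + 1)) (at p)"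
proof -
  consider "p < 0" | "p > 0" | "p = 0" by linarith
  then show ?thesis
  proof cases
    case 1
    have "((\<lambda>p::real. 0) has_real_derivative 0) (at p)" by simp
    then have "((\<lambda>p::real. (max 0 p) ^ (k + 2)) has_real_derivative 0) (at p)"
      by (rule has_field_derivative_transform_within[where d = "- p"])
        (use 1 in \<open>auto simp: dist_real_def max_def\<close>)
    then show ?thesis using 1 by simp
  next
    case 2
    have "((\<lambda>p::real. p ^ (k + 2)) has_real_derivative real (k + 2) * p ^ (k + 1)) (at p)"
      using DERIV_pow[of "k + 2" p] by simp
    then have "((\<lambda>p::real. (max 0 p) ^ (k + 2)) has_real_derivative real (k + 2) * p ^ (k + 1)) (at p)"
      by (rule has_field_derivative_transform_within[where d = p])
        (use 2 in \<open>auto simp: dist_real_def max_def\<close>)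
    then show ?thesis using 2 by simp
  next
    case 3
    have "((\<lambda>h::real. (max 0 h) ^ (k + 1)) \<longlongrightarrow> (max 0 0) ^ (k + 1)) (at 0)"
      by (intro tendsto_intros)
    moreover have "\<forall>\<^sub>F h::real in at 0.
        (max 0 h) ^ (k + 1) = ((max 0 (0 + h)) ^ (k + 2) - (max 0 0) ^ (k + 2)) / h"
      by (auto simp: eventually_at_filter max_def)
    ultimately have "((\<lambda>h::real. ((max 0 (0 + h)) ^ (k + 2) - (max 0 0) ^ (k + 2)) / h)
        \<longlongrightarrow> (max 0 0) ^ (k + 1)) (at 0)"
      by (rule Lim_transform_eventually)
    then show ?thesis using 3 by (simp add: DERIV_def)
  qed
qed

text \<open>Meant for \<open>m k\<close> the sum of two outer normals and \<open>b k\<close> the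
  number \<delta> minus their two support constants: then \<open>m k \<bullet> x + b k\<close> is
  \<delta> minus the distances of \<open>x\<close> to the two facet hyperplanes. The divisor 6 makes
  the Hessian contribute \<open>K\<close> times the plain positive part.\<close>

definition ridge_potential ::
  "real \<Rightarrow> 'k set \<Rightarrow> ('k \<Rightarrow> 'a::euclidean_space) \<Rightarrow> ('k \<Rightarrow> real) \<Rightarrow> 'a \<Rightarrow> real" where
  "ridge_potential K P m b x = (x \<bullet> x) / 2 + K * (\<Sum>k\<in>P. (max 0 (m k \<bullet> x + b k)) ^ 3 / 6)"

definition ridge_gradient ::
  "real \<Rightarrow> 'k set \<Rightarrow> ('k \<Rightarrow> 'a::euclidean_space) \<Rightarrow> ('k \<Rightarrow> real) \<Rightarrow> 'a \<Rightarrow> 'a" where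
  "ridge_gradient K P m b x = x + K *\<^sub>R (\<Sum>k\<in>P. ((max 0 (m k \<bullet> x + b k)) ^ 2 / 2) *\<^sub>R m k)"

text \<open>Kept as a map, in the form in which the sign lemmas below solve \<open>H z = g\<close>;
  it becomes a matrix only when matched with \<open>C2_derivs\<close>.\<close>

definition ridge_hessian ::
  "real \<Rightarrow> 'k set \<Rightarrow> ('k \<Rightarrow> 'a::euclidean_space) \<Rightarrow> ('k \<Rightarrow> real) \<Rightarrow> 'a \<Rightarrow> 'a \<Rightarrow> 'a" where
  "ridge_hessian K P m b x v = v + K *\<^sub>R (\<Sum>k\<in>P. (max 0 (m k \<bullet> x + b k) * (m k \<bullet> v)) *\<^sub>R m k)"

lemma has_derivative_max0_affine:
  fixes m :: "'a::euclidean_space"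
  shows "((\<lambda>x. (max 0 (m \<bullet> x + b)) ^ (k + 2)) has_derivative
    (\<lambda>v. real (k + 2) * (max 0 (m \<bullet> x + b)) ^ (k + 1) * (m \<bullet> v))) (at x)"
proof -
  have "((\<lambda>x. m \<bullet> x + b) has_derivative (\<lambda>v. m \<bullet> v)) (at x)"
    by (auto intro!: derivative_eq_intros)
  from has_derivative_compose[OF this DERIV_max0_power[unfolded has_field_derivative_def]]
  show ?thesis by simp
qed

lemma ridge_potential_derivative:
  "(ridge_potential K P m b has_derivative (\<lambda>v. ridge_gradient K P m b x \<bullet> v)) (at x)"
proof -
  have "((\<lambda>x. (max 0 (m k \<bullet> x + b k)) ^ 3 / 6) has_derivative
     (\<lambda>v. ((max 0 (m k \<bullet> x + b k)) ^ 2 / 2) * (m k \<bullet> v))) (at x)" for k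
    using has_derivative_mult_right[OF has_derivative_max0_affine[of "m k" "b k" 1 x], of "1/6"]
    by (simp add: numeral_3_eq_3 numeral_2_eq_2 field_simps)
  then have "((\<lambda>x. K * (\<Sum>k\<in>P. (max 0 (m k \<bullet> x + b k)) ^ 3 / 6)) has_derivative
     (\<lambda>v. K * (\<Sum>k\<in>P. ((max 0 (m k \<bullet> x + b k)) ^ 2 / 2) * (m k \<bullet> v)))) (at x)"
    by (intro has_derivative_mult_right has_derivative_sum)
  moreover have "((\<lambda>x. (x \<bullet> x) / 2) has_derivative (\<lambda>v. x \<bullet> v)) (at x)"
    by (auto intro!: derivative_eq_intros simp: inner_commute)
  ultimately have "((\<lambda>x. (x \<bullet> x) / 2 + K * (\<Sum>k\<in>P. (max 0 (m k \<bullet> x + b k)) ^ 3 / 6)) has_derivative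
     (\<lambda>v. x \<bullet> v + K * (\<Sum>k\<in>P. ((max 0 (m k \<bullet> x + b k)) ^ 2 / 2) * (m k \<bullet> v)))) (at x)"
    using has_derivative_add by blast
  then show ?thesis
    unfolding ridge_potential_def[abs_def] ridge_gradient_def
    by (simp add: inner_add_left inner_sum_left)
qed

lemma ridge_gradient_derivative:
  "(ridge_gradient K P m b has_derivative ridge_hessian K P m b x) (at x)"
proof -
  have "((\<lambda>x. (max 0 (m k \<bullet> x + b k)) ^ 2 / 2) has_derivative
     (\<lambda>v. max 0 (m k \<bullet> x + b k) * (m k \<bullet> v))) (at x)" for k
    using has_derivative_mult_right[OF has_derivative_max0_affine[of "m k" "b k" 0 x], of "1/2"]
    by (simp add: numeral_2_eq_2)
  then have "((\<lambda>x. K *\<^sub>R (\<Sum>k\<in>P. ((max 0 (m k \<bullet> x + b k)) ^ 2 / 2) *\<^sub>R m k)) has_derivative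
     (\<lambda>v. K *\<^sub>R (\<Sum>k\<in>P. (max 0 (m k \<bullet> x + b k) * (m k \<bullet> v)) *\<^sub>R m k))) (at x)"
    by (intro has_derivative_scaleR_right has_derivative_sum has_derivative_scaleR_left)
  then show ?thesis
    unfolding ridge_gradient_def[abs_def] ridge_hessian_def[abs_def]
    by (intro has_derivative_add has_derivative_ident)
qed

lemma linear_ridge_hessian: "linear (ridge_hessian K P m b x)"
  using has_derivative_linear[OF ridge_gradient_derivative] .

lemma ridge_potential_C2_derivs:
  fixes m :: "'k \<Rightarrow> real ^ 'n"
  shows "C2_derivs S (ridge_potential K P m b) (ridge_gradient K P m b) (\<lambda>x. matrix (ridge_hessian K P m b x))"
proof -
  have "continuous_on S (\<lambda>x. matrix (ridge_hessian K P m b x))"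
    unfolding matrix_def ridge_hessian_def by (intro continuous_intros)
  moreover have "continuous_on S (ridge_potential K P m b)" "continuous_on S (ridge_gradient K P m b)"
    using has_derivative_continuous[OF ridge_potential_derivative] has_derivative_continuous[OF ridge_gradient_derivative]
    by (blast intro: continuous_at_imp_continuous_on)+
  moreover have "(ridge_gradient K P m b has_derivative (*v) (matrix (ridge_hessian K P m b x))) (at x)" for x
    using ridge_gradient_derivative[of K P m b x] by (simp add: matrix_works linear_matrix_vector_mul_eq linear_ridge_hessian)
  ultimately show ?thesis
    unfolding C2_derivs_def using ridge_potential_derivative by blast
qed

text \<open>Every added term is a nonnegative multiple of a square. Besides uniform convexity with
  constant 1, this provides the premise \<open>0 \<le> g \<bullet> z\<close> of the sign lemmas,
  since there \<open>g\<close> is the Hessian applied to \<open>z\<close>.\<close>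

lemma ridge_hessian_quadratic:
  assumes "0 \<le> K"
  shows "v \<bullet> v \<le> v \<bullet> ridge_hessian K P m b x v"
proof -
  have "v \<bullet> ridge_hessian K P m b x v = v \<bullet> v + K * (\<Sum>k\<in>P. max 0 (m k \<bullet> x + b k) * (m k \<bullet> v)\<^sup>2)"
    unfolding ridge_hessian_def
    by (simp add: inner_add_right inner_sum_right inner_commute power2_eq_square mult.assoc)
  moreover have "0 \<le> (\<Sum>k\<in>P. max 0 (m k \<bullet> x + b k) * (m k \<bullet> v)\<^sup>2)"
    by (intro sum_nonneg mult_nonneg_nonneg) auto
  ultimately show ?thesis using assms by simp
qed

lemma convex_on_inner_self: "convex_on S (\<lambda>x::'a::euclidean_space. (x \<bullet> x) / 2)" if "convex S"
proof (rule convex_onI[OF _ that])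
  fix t :: real and x y :: 'a assume t: "0 < t" "t < 1"
  have "(1 - t) * ((x \<bullet> x) / 2) + t * ((y \<bullet> y) / 2)
      - (((1 - t) *\<^sub>R x + t *\<^sub>R y) \<bullet> ((1 - t) *\<^sub>R x + t *\<^sub>R y)) / 2 = t * (1 - t) * ((x - y) \<bullet> (x - y)) / 2"
    by (simp add: inner_add_left inner_add_right inner_diff_left inner_diff_right inner_commute field_simps)
  moreover have "0 \<le> t * (1 - t) * ((x - y) \<bullet> (x - y)) / 2" using t by simp
  ultimately show "(((1 - t) *\<^sub>R x + t *\<^sub>R y) \<bullet> ((1 - t) *\<^sub>R x + t *\<^sub>R y)) / 2
      \<le> (1 - t) * ((x \<bullet> x) / 2) + t * ((y \<bullet> y) / 2)" by linarith
qed

lemma convex_on_max0_cube: "convex_on UNIV (\<lambda>p::real. (max 0 p) ^ 3 / 6)"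
proof (rule convex_on_realI)
  show "((\<lambda>p::real. (max 0 p) ^ 3 / 6) has_real_derivative (max 0 p) ^ 2 / 2) (at p)" for p
    using DERIV_cdivide[OF DERIV_max0_power[of 1 p], of 6] by (simp add: numeral_3_eq_3 numeral_2_eq_2)
qed (auto intro!: divide_right_mono power_mono)

lemma convex_on_ridge_potential:
  assumes "0 \<le> K" "convex S" "finite P"
  shows "convex_on S (ridge_potential K P m b)"
proof -
  have "convex_on S (\<lambda>x. (max 0 (m k \<bullet> x + b k)) ^ 3 / 6)" for k
  proof (rule convex_onI[OF _ assms(2)])
    fix t :: real and x y :: 'a assume t: "0 < t" "t < 1"
    have "m k \<bullet> ((1 - t) *\<^sub>R x + t *\<^sub>R y) + b k = (1 - t) *\<^sub>R (m k \<bullet> x + b k) + t *\<^sub>R (m k \<bullet> y + b k)"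
      by (simp add: inner_add_right algebra_simps)
    then show "(max 0 (m k \<bullet> ((1 - t) *\<^sub>R x + t *\<^sub>R y) + b k)) ^ 3 / 6
      \<le> (1 - t) * ((max 0 (m k \<bullet> x + b k)) ^ 3 / 6) + t * ((max 0 (m k \<bullet> y + b k)) ^ 3 / 6)"
      using convex_onD[OF convex_on_max0_cube, of t "m k \<bullet> x + b k" "m k \<bullet> y + b k"] t by simp
  qed
  note cube = this
  have "convex_on S (\<lambda>x. \<Sum>k\<in>P. (max 0 (m k \<bullet> x + b k)) ^ 3 / 6)"
    using assms(3) by (induction rule: finite_induct) (simp_all add: convex_on_const assms(2) convex_on_add cube)
  then show ?thesis
    unfolding ridge_potential_def[abs_def]
    by (intro convex_on_add convex_on_inner_self convex_on_cmul assms)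
qed

text \<open>For a potential with Hessian \<open>H\<close> the dihedral angle between the facets with normals \<open>f\<close> and
  \<open>g\<close> is nonobtuse iff \<open>f \<bullet> z \<le> 0\<close> where \<open>H z = g\<close>. Along an edge of a simple polytope in dimension at
  most three, \<open>H\<close> is the sum of the identity and a large multiple of \<open>(f + g) \<otimes> (f + g)\<close>, plus, close to
  a vertex on a third facet with normal \<open>k\<close>, a smaller multiple of
  \<open>(f + k) \<otimes> (f + k) + (g + k) \<otimes> (g + k)\<close>.\<close>

lemma edge_sign:
  fixes f g :: "'a::euclidean_space"
  assumes f: "norm f = 1" "norm g = 1" and fg: "\<bar>f \<bullet> g\<bar> < 1"
  shows "\<exists>K0. \<forall>K\<ge>K0. \<forall>z. z + K *\<^sub>R (((f + g) \<bullet> z) *\<^sub>R (f + g)) = g \<longrightarrow> 0 \<le> g \<bullet> z \<longrightarrow> f \<bullet> z \<le> 0"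
\<comment> \<open>In the notation below this is the absolute value of \<open>c * d\<close>; pairing
  the equation with \<open>p\<close> leaves \<open>a * (d + K) = - b * (K - c * d)\<close>, so
  \<open>K\<close> has to exceed \<open>c * d\<close> and be nonnegative.\<close>
proof (intro exI[of _ "\<bar>(f \<bullet> g) / (1 - (f \<bullet> g)\<^sup>2)\<bar>"] allI impI)
  fix K z assume K: "\<bar>(f \<bullet> g) / (1 - (f \<bullet> g)\<^sup>2)\<bar> \<le> K"
    and z: "z + K *\<^sub>R (((f + g) \<bullet> z) *\<^sub>R (f + g)) = g" and b0: "0 \<le> g \<bullet> z"
  define c where "c = f \<bullet> g"
  define a where "a = f \<bullet> z"
  define b where "b = g \<bullet> z"
  define d where "d = 1 / (1 - c\<^sup>2)"
  have c2: "c\<^sup>2 < 1" using fg unfolding c_def by (simp add: abs_square_less_1)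
  then have d: "0 < d" unfolding d_def by simp
  have ff: "f \<bullet> f = 1" "g \<bullet> g = 1" using f by (auto simp: norm_eq_1)
  \<comment> \<open>The vector of the span of \<open>f\<close> and \<open>g\<close> dual to
    \<open>f\<close>; pairing with it removes the right-hand side \<open>g\<close>.\<close>
  define p where "p = d *\<^sub>R (f - c *\<^sub>R g)"
  have pf: "p \<bullet> f = 1" "p \<bullet> g = 0"
    using c2 by (simp_all add: p_def inner_diff_left inner_diff_right ff c_def d_def inner_commute power2_eq_square)
  have pz: "p \<bullet> z = d * a - c * d * b"
    unfolding p_def a_def b_def by (simp add: inner_diff_left algebra_simps)
  have "p \<bullet> (z + K *\<^sub>R (((f + g) \<bullet> z) *\<^sub>R (f + g))) = 0" using z pf by simp
  then have "d * a - c * d * b + K * (a + b) = 0"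
    by (simp add: inner_add_right inner_add_left pf pz a_def b_def)
  then have "a * (d + K) = - b * (K - c * d)" by (simp add: algebra_simps)
  moreover have "\<bar>c * d\<bar> \<le> K" using K unfolding c_def d_def by simp
  then have "c * d \<le> K" "0 \<le> K" by linarith+
  then have "0 \<le> b * (K - c * d)" using b0 unfolding b_def by simp
  ultimately have "a * (d + K) \<le> 0" by simp
  then show "f \<bullet> z \<le> 0" using d \<open>0 \<le> K\<close> unfolding a_def by (simp add: mult_le_0_iff)
qed

text \<open>The threshold must not depend on \<tau>, which varies along the edge: \<tau> = 1 at the
  corner, and \<tau> = 0 where the third facet stops acting and the equation is that of
  \<open>edge_sign\<close>.\<close>

lemma corner_sign:
  fixes f g k :: "'a::euclidean_space"
  assumes f: "norm f = 1" "norm g = 1" and fg: "\<bar>f \<bullet> g\<bar> < 1" and k: "k \<notin> span {f, g}"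
  shows "\<exists>K0. \<forall>K\<ge>K0. \<forall>\<tau> z. 0 \<le> \<tau> \<longrightarrow> \<tau> \<le> 1 \<longrightarrow>
    z + K *\<^sub>R (((f + g) \<bullet> z) *\<^sub>R (f + g) + \<tau> *\<^sub>R (((f + k) \<bullet> z) *\<^sub>R (f + k) + ((g + k) \<bullet> z) *\<^sub>R (g + k))) = g
    \<longrightarrow> 0 \<le> g \<bullet> z \<longrightarrow> f \<bullet> z \<le> 0"
proof -
  define c where "c = f \<bullet> g"
  define d where "d = 1 / (1 - c\<^sup>2)"
  have c2: "c\<^sup>2 < 1" using fg unfolding c_def by (simp add: abs_square_less_1)
  then have d: "0 < d" unfolding d_def by simp
  have ff: "f \<bullet> f = 1" "g \<bullet> g = 1" using f by (auto simp: norm_eq_1)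
  define p where "p = d *\<^sub>R (f - c *\<^sub>R g)"
  define q where "q = d *\<^sub>R (g - c *\<^sub>R f)"
  have pf: "p \<bullet> f = 1" "p \<bullet> g = 0" "q \<bullet> f = 0" "q \<bullet> g = 1"
    using c2 by (simp_all add: p_def q_def inner_diff_left inner_diff_right ff c_def d_def inner_commute power2_eq_square)
  \<comment> \<open>\<open>X\<close> and \<open>Y\<close> are the coordinates in \<open>f\<close>,
    \<open>g\<close> of the orthogonal projection of \<open>k\<close> to their span, and
    \<open>e\<close> is the remainder, nonzero because \<open>k\<close> is outside the span.\<close>
  define X where "X = p \<bullet> k"
  define Y where "Y = q \<bullet> k"
  define e where "e = k - X *\<^sub>R f - Y *\<^sub>R g"
  \<comment> \<open>\<open>f\<close>, \<open>g\<close>, \<open>k\<close> pair with \<open>p\<close>, \<open>q\<close>, \<open>e\<close> in triangular form, so eliminating the \<open>e\<close>-component of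
    \<open>H z = g\<close> leaves a cofactor of the Gram matrix of \<open>H\<close> in this basis.\<close>
  have pe: "p \<bullet> e = 0" "q \<bullet> e = 0" unfolding e_def by (simp_all add: inner_diff_right pf X_def Y_def)
  have fg_e: "f \<bullet> e = c * (g \<bullet> e)" "g \<bullet> e = c * (f \<bullet> e)"
    using pe d by (simp_all add: p_def q_def inner_diff_left)
  then have "(f \<bullet> e) * (1 - c\<^sup>2) = 0" by algebra
  then have "f \<bullet> e = 0" using c2 by simp
  with fg_e(2) have fe: "f \<bullet> e = 0" "g \<bullet> e = 0" by simp_all
  have "X *\<^sub>R f + Y *\<^sub>R g \<in> span {f, g}" by (intro span_add span_mul span_base) auto
  then have "e \<noteq> 0" using k unfolding e_def by (auto simp: algebra_simps)
  define \<epsilon> where "\<epsilon> = 1 / (e \<bullet> e)"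
  have \<epsilon>: "0 < \<epsilon>" using \<open>e \<noteq> 0\<close> unfolding \<epsilon>_def by simp
  have "k = e + X *\<^sub>R f + Y *\<^sub>R g" unfolding e_def by simp
  then have "e \<bullet> k = e \<bullet> (e + X *\<^sub>R f + Y *\<^sub>R g)" by simp
  then have ek: "e \<bullet> k = e \<bullet> e" using fe by (simp add: inner_add_right inner_commute)
  \<comment> \<open>The coefficient of \<open>K * \<tau>\<close> in the mixed cofactor below that
    does not grow with \<open>K\<close>; it may be negative, so \<open>K\<close> has to dominate
    it.\<close>
  define W where "W = \<epsilon> * (X + Y + 2 * X * Y) - 2 * c * d"
  show ?thesis
  proof (intro exI[of _ "\<bar>c * d\<bar> + \<bar>W\<bar>"] allI impI)
    fix K \<tau> z
    assume K: "\<bar>c * d\<bar> + \<bar>W\<bar> \<le> K" and \<tau>: "0 \<le> \<tau>" "\<tau> \<le> 1" and b0: "0 \<le> g \<bullet> z"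
      and z: "z + K *\<^sub>R (((f + g) \<bullet> z) *\<^sub>R (f + g) + \<tau> *\<^sub>R (((f + k) \<bullet> z) *\<^sub>R (f + k) + ((g + k) \<bullet> z) *\<^sub>R (g + k))) = g"
    define a where "a = f \<bullet> z"
    define b where "b = g \<bullet> z"
    define y where "y = k \<bullet> z"
    define s where "s = e \<bullet> z"
    have y: "y = X * a + Y * b + s"
      unfolding y_def a_def b_def s_def e_def by (simp add: inner_diff_left)
    have pz: "p \<bullet> z = d * a - c * d * b"
      unfolding p_def a_def b_def by (simp add: inner_diff_left algebra_simps)
    have "p \<bullet> (z + K *\<^sub>R (((f + g) \<bullet> z) *\<^sub>R (f + g) + \<tau> *\<^sub>R (((f + k) \<bullet> z) *\<^sub>R (f + k) + ((g + k) \<bullet> z) *\<^sub>R (g + k)))) = 0"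
      using z pf by simp
    then have 1: "d * a - c * d * b + K * ((a + b) + \<tau> * ((a + y) * (1 + X) + (b + y) * X)) = 0"
      by (simp add: inner_add_right inner_add_left pf pz X_def a_def b_def y_def)
    have "e \<bullet> (z + K *\<^sub>R (((f + g) \<bullet> z) *\<^sub>R (f + g) + \<tau> *\<^sub>R (((f + k) \<bullet> z) *\<^sub>R (f + k) + ((g + k) \<bullet> z) *\<^sub>R (g + k)))) = 0"
      using z fe by (simp add: inner_commute)
    then have "s + K * (\<tau> * ((a + y) * (e \<bullet> e) + (b + y) * (e \<bullet> e))) = 0"
      using fe by (simp add: inner_add_right inner_add_left ek s_def a_def b_def y_def inner_commute[of e f] inner_commute[of e g])
    then have "\<epsilon> * (s + K * (\<tau> * ((a + y) * (e \<bullet> e) + (b + y) * (e \<bullet> e)))) = 0" by simp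
    moreover have "\<epsilon> * (e \<bullet> e) = 1" using \<open>e \<noteq> 0\<close> unfolding \<epsilon>_def by simp
    ultimately have 2: "\<epsilon> * s + K * \<tau> * (a + b + 2 * y) = 0" by algebra
    \<comment> \<open>Entries of the quadratic form of \<open>H\<close> in the basis
      \<open>p\<close>, \<open>q\<close>, \<open>\<epsilon> *\<^sub>R e\<close>, in which
      \<open>z\<close> has coordinates \<open>a\<close>, \<open>b\<close>, \<open>s\<close>. The
      last basis vector is scaled so as to pair to 1 with \<open>k\<close>.\<close>
    define Bpp where "Bpp = d + K * (1 + \<tau> * ((1 + X)\<^sup>2 + X\<^sup>2))"
    define Bpq where "Bpq = - c * d + K * (1 + \<tau> * (X + Y + 2 * X * Y))"
    define Bpe where "Bpe = K * \<tau> * (1 + 2 * X)"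
    define Bqe where "Bqe = K * \<tau> * (1 + 2 * Y)"
    define Bee where "Bee = \<epsilon> + 2 * K * \<tau>"
    have "a * Bpp + b * Bpq + s * Bpe = 0"
      using 1 unfolding y Bpp_def Bpq_def Bpe_def by (simp add: algebra_simps power2_eq_square)
    moreover have "a * Bpe + b * Bqe + s * Bee = 0"
      using 2 unfolding y Bpe_def Bqe_def Bee_def by (simp add: algebra_simps)
    ultimately have key: "a * (Bpp * Bee - Bpe\<^sup>2) = - b * (Bpq * Bee - Bpe * Bqe)" by algebra
    have K0: "0 \<le> K" "c * d \<le> K" "- W \<le> K" using K by linarith+
    \<comment> \<open>In the terms with the square of \<open>K * \<tau>\<close> everything involving
      \<open>X\<close> cancels and leaves coefficient 1, so positivity is visible term by
      term.\<close>
    have "Bpp * Bee - Bpe\<^sup>2 = d * \<epsilon> + 2 * d * K * \<tau> + \<epsilon> * (K * (1 + \<tau> * ((1 + X)\<^sup>2 + X\<^sup>2))) + 2 * K * K * \<tau> + K * K * (\<tau> * \<tau>)"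
      unfolding Bpp_def Bee_def Bpe_def by (simp add: algebra_simps power2_eq_square)
    moreover have "0 \<le> \<epsilon> * (K * (1 + \<tau> * ((1 + X)\<^sup>2 + X\<^sup>2)))" "0 \<le> 2 * d * K * \<tau>" "0 \<le> 2 * K * K * \<tau>"
      "0 \<le> K * K * (\<tau> * \<tau>)" "0 < d * \<epsilon>"
      using \<epsilon> d K0 \<tau> by simp_all
    ultimately have pos: "0 < Bpp * Bee - Bpe\<^sup>2" by linarith
    \<comment> \<open>Here too \<open>X\<close> and \<open>Y\<close> cancel in the terms with the
      square of \<open>K * \<tau>\<close>. The first summand handles small \<tau>; in the second the
      factor \<open>2 - \<tau>\<close> is at least 1, so \<open>K\<close> beats
      \<open>W\<close>.\<close>
    have "Bpq * Bee - Bpe * Bqe = \<epsilon> * (K - c * d) + K * \<tau> * (W + K * (2 - \<tau>))"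
      unfolding Bpq_def Bee_def Bpe_def Bqe_def W_def by (simp add: algebra_simps power2_eq_square)
    moreover have "K \<le> K * (2 - \<tau>)" using K0 \<tau> by (simp add: mult_le_cancel_left1)
    then have "0 \<le> K * \<tau> * (W + K * (2 - \<tau>))" using K0 \<tau> by simp
    moreover have "0 \<le> \<epsilon> * (K - c * d)" using \<epsilon> K0 by simp
    ultimately have "0 \<le> Bpq * Bee - Bpe * Bqe" by linarith
    then have "a * (Bpp * Bee - Bpe\<^sup>2) \<le> 0" using key b0 unfolding b_def by simp
    then show "f \<bullet> z \<le> 0" using pos unfolding a_def by (simp add: mult_le_0_iff)
  qed
qed

section \<open>Active facets\<close>

lemma independent_if_dual:
  fixes S :: "'a::euclidean_space set"
  assumes "finite S" and dual: "\<And>a. a \<in> S \<Longrightarrow> \<exists>d. a \<bullet> d \<noteq> 0 \<and> (\<forall>b\<in>S. b \<noteq> a \<longrightarrow> b \<bullet> d = 0)"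
  shows "independent S"
proof -
  have "u a = 0" if u: "(\<Sum>v\<in>S. u v *\<^sub>R v) = 0" and a: "a \<in> S" for u a
  proof -
    obtain d where d: "a \<bullet> d \<noteq> 0" "\<forall>b\<in>S. b \<noteq> a \<longrightarrow> b \<bullet> d = 0" using dual[OF a] by blast
    have "0 = (\<Sum>v\<in>S. u v * (v \<bullet> d))"
      using arg_cong[OF u, of "\<lambda>x. x \<bullet> d"] by (simp add: inner_sum_left)
    also have "\<dots> = (\<Sum>v\<in>S. if v = a then u a * (a \<bullet> d) else 0)"
      using d by (intro sum.cong) auto
    also have "\<dots> = u a * (a \<bullet> d)" using assms(1) a by simp
    finally show ?thesis using d by simp
  qed
  then show ?thesis using assms(1) by (auto simp: independent_explicit)
qed

lemma finite_uniform_bound: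
  assumes "finite S" and "\<And>s. s \<in> S \<Longrightarrow> \<exists>K0::real. \<forall>K\<ge>K0. Q s K"
  shows "\<exists>K0. \<forall>s\<in>S. \<forall>K\<ge>K0. Q s K"
proof -
  have "\<forall>s\<in>S. \<forall>\<^sub>F K in at_top. Q s K"
    using assms(2) by (simp add: eventually_at_top_linorder)
  then have "\<forall>\<^sub>F K in at_top. \<forall>s\<in>S. Q s K"
    using assms(1) by (simp add: eventually_ball_finite_distrib)
  then show ?thesis by (auto simp: eventually_at_top_linorder)
qed

text \<open>A relative interior point of \<open>F\<close> is a boundary point of \<open>V\<close>,
  so some constraint is tight there. The face which that constraint cuts out contains
  \<open>F\<close>, and is proper because \<open>d i\<close> is nonzero; hence it is
  \<open>F\<close>.\<close>

lemma facet_of_halfspaces_cone: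
  fixes d :: "'i \<Rightarrow> real ^ 'n"
  assumes J: "finite J" and V: "V = {v. \<forall>i\<in>J. d i \<bullet> v \<le> 0}" "interior V \<noteq> {}"
    and d0: "\<And>i. i \<in> J \<Longrightarrow> d i \<noteq> 0" and F: "F facet_of V"
  obtains i where "i \<in> J" "F = V \<inter> {v. d i \<bullet> v = 0}" "outer_normal V F = sgn (d i)"
proof -
  have pV: "polyhedron V" unfolding V(1) using halfspaces_polyhedron[OF J, where d = d and c = "\<lambda>_. 0"] .
  have cV: "convex V" using pV by (rule polyhedron_imp_convex)
  have "polyhedron F" using pV F face_of_polyhedron_polyhedron facet_of_imp_face_of by blast
  then have "rel_interior F \<noteq> {}"
    using F by (simp add: facet_of_def rel_interior_eq_empty polyhedron_imp_convex)
  then obtain v where v: "v \<in> rel_interior F" by blast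
  then have vV: "v \<in> F" "v \<in> V" using rel_interior_subset facet_of_imp_subset[OF F] by blast+
  have hull: "affine hull V = UNIV"
    using V(2) aff_dim_eq_full[of V] by (simp add: aff_dim_nonempty_interior)
  have "v \<notin> interior V"
    using vV F rel_boundary_of_polyhedron[OF pV] rel_interior_interior[OF hull] by blast
  have "\<exists>i\<in>J. d i \<bullet> v = 0"
  proof (rule ccontr)
    assume "\<not> ?thesis"
    then have "v \<in> (\<Inter>i\<in>J. {v. d i \<bullet> v < 0})" using vV(2) unfolding V(1) by (auto simp: order_less_le)
    moreover have "open (\<Inter>i\<in>J. {v. d i \<bullet> v < 0})" using J by (intro open_INT) (auto simp: open_halfspace_lt)
    moreover have "(\<Inter>i\<in>J. {v. d i \<bullet> v < 0}) \<subseteq> V" unfolding V(1) by (auto intro: less_imp_le)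
    ultimately have "v \<in> interior V" by (metis interiorI)
    then show False using \<open>v \<notin> interior V\<close> by blast
  qed
  then obtain i where i: "i \<in> J" "d i \<bullet> v = 0" by blast
  define G where "G = V \<inter> {v. d i \<bullet> v = 0}"
  have Gf: "G face_of V"
    unfolding G_def using i(1) V(1) by (intro face_of_Int_supporting_hyperplane_le cV) auto
  have "v \<in> G" unfolding G_def using i vV by simp
  then have FG: "F \<subseteq> G"
    using subset_of_face_of[OF Gf facet_of_imp_subset[OF F]] v by blast
  have "G \<noteq> V"
  proof
    assume "G = V"
    then have "aff_dim V \<le> aff_dim {v. d i \<bullet> v = 0}" unfolding G_def by (metis aff_dim_subset inf.cobounded2)
    then show False using d0[OF i(1)] V(2) by (simp add: aff_dim_nonempty_interior aff_dim_hyperplane)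
  qed
  then have FGe: "F = G" using facet_subset_face_eq[OF cV F Gf _ FG] by blast
  have "outer_normal V F = sgn (d i)"
  proof (rule outer_normal_eqI[OF V(2) F])
    show "norm (sgn (d i)) = 1" using d0[OF i(1)] by (simp add: norm_sgn)
    show "\<forall>x\<in>V. sgn (d i) \<bullet> x \<le> 0"
      using i(1) V(1) by (auto simp: sgn_div_norm mult_nonneg_nonpos)
    show "\<forall>x\<in>F. sgn (d i) \<bullet> x = 0" unfolding FGe G_def by (simp add: sgn_div_norm)
  qed
  then show ?thesis using that i(1) FGe unfolding G_def by blast
qed

text \<open>Guarantees that the maximum in \<open>Theta\<close> is over a nonempty set. A polyhedron
  without facets is affine. \<open>V\<close> is not, so it has a facet \<open>F\<close>. If
  \<open>F\<close> were affine it would be a whole hyperplane, and the part of a nonparallel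
  \<open>d j\<close> inside it would violate constraint \<open>j\<close>; so \<open>F\<close> has a
  facet, which is a ridge of \<open>V\<close>.\<close>

lemma adjacent_facets_exist:
  fixes d :: "'i \<Rightarrow> real ^ 'n"
  assumes J: "finite J" "J \<noteq> {}" and V: "V = {v. \<forall>i\<in>J. d i \<bullet> v \<le> 0}" "interior V \<noteq> {}"
    and d0: "\<And>i. i \<in> J \<Longrightarrow> d i \<noteq> 0" and npar: "\<And>i. i \<in> J \<Longrightarrow> \<exists>j\<in>J. \<forall>r. d j \<noteq> r *\<^sub>R d i"
  shows "\<exists>F G. adjacent_facets V F G"
proof -
  have pV: "polyhedron V" unfolding V(1) using halfspaces_polyhedron[OF J(1), where d = d and c = "\<lambda>_. 0"] .
  have hull: "affine hull V = UNIV"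
    using V(2) aff_dim_eq_full[of V] by (simp add: aff_dim_nonempty_interior)
  have "\<not> affine V"
  proof
    assume "affine V"
    then have "V = UNIV" using hull by (metis affine_hull_eq)
    moreover obtain i where "i \<in> J" using J by blast
    ultimately have "d i \<bullet> d i \<le> 0" using V(1) by blast
    then show False using d0 \<open>i \<in> J\<close> by (metis inner_eq_zero_iff inner_ge_zero order_antisym)
  qed
  then obtain F where F: "F facet_of V"
    using rel_frontier_eq_empty[of V] rel_frontier_of_polyhedron[OF pV] by blast
  obtain i where i: "i \<in> J" "F = V \<inter> {v. d i \<bullet> v = 0}"
    using facet_of_halfspaces_cone[OF J(1) V d0 F] by metis
  obtain j where j: "j \<in> J" "\<And>r. d j \<noteq> r *\<^sub>R d i" using npar[OF i(1)] by blast
  have pF: "polyhedron F" using pV F face_of_polyhedron_polyhedron facet_of_imp_face_of by blast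
  have "\<not> affine F"
  proof
    assume "affine F"
    have "affine hull F = {v. d i \<bullet> v = 0}"
      using d0[OF i(1)] i(2) by (intro facet_affine_hull[OF V(2) F]) auto
    then have FH: "F = {v. d i \<bullet> v = 0}" using \<open>affine F\<close> by (metis affine_hull_eq)
    define w where "w = d j - ((d i \<bullet> d j) / (d i \<bullet> d i)) *\<^sub>R d i"
    have iw: "d i \<bullet> w = 0" unfolding w_def using d0[OF i(1)] by (simp add: inner_diff_right)
    then have "w \<in> V" using FH i(2) by blast
    then have "d j \<bullet> w \<le> 0" using V(1) j(1) by blast
    then have "w \<bullet> w \<le> 0" using iw by (simp add: w_def inner_diff_left)
    then have "w = 0" by (metis inner_ge_zero inner_eq_zero_iff order_antisym)
    then show False using j(2) unfolding w_def by (metis eq_iff_diff_eq_0)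
  qed
  then obtain R where "R facet_of F"
    using rel_frontier_eq_empty[of F] rel_frontier_of_polyhedron[OF pF] by blast
  then show ?thesis using ridge_adjacent[OF pV V(2) F] by metis
qed

context facet_normals
begin

lemma active_eqI:
  assumes "F facet_of \<Omega>" "G facet_of \<Omega>" "n F = n G" "c F = c G"
  shows "F = G"
  using assms normals by metis

lemma inj_on_active: "inj_on n (active x)"
proof (rule inj_onI)
  fix F G assume FG: "F \<in> active x" "G \<in> active x" "n F = n G"
  then have "c F = c G" unfolding active_def by (metis (mono_tags, lifting) mem_Collect_eq)
  then show "F = G" using FG active_eqI unfolding active_def by blast
qed

text \<open>In orthant coordinates each active facet lies in a coordinate hyperplane, so its normal
  is a nonzero multiple of a row of \<open>A\<close>. Different facets use different rows, and the
  columns of the inverse matrix are dual to the rows.\<close>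

lemma simple_extreme_independent:
  assumes simple: "simple_polytope \<Omega>" and x: "x extreme_point_of \<Omega>"
  shows "independent (n ` active x)"
proof -
  have xO: "x \<in> \<Omega>" using x unfolding extreme_point_of_def by simp
  define V where "V = tangent_cone \<Omega> x"
  obtain A b where A: "invertible (A :: real ^ 'n ^ 'n)" and img: "(\<lambda>v. A *v v + b) ` V = {y. \<forall>i. 0 \<le> y $ i}"
    using simple x unfolding simple_polytope_def affine_transformation_def V_def by blast
  have V: "V = {v. \<forall>F\<in>active x. n F \<bullet> v \<le> 0}" unfolding V_def by (rule tangent_cone_eq[OF xO])
  \<comment> \<open>If \<open>v\<close> is mapped to the origin, then 0 and
    \<open>2 *\<^sub>R v\<close> are mapped to \<open>b\<close> and \<open>- b\<close>, and the
    orthant contains both only if \<open>b\<close> is 0.\<close>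
  have b: "b = 0"
  proof -
    have "(0 :: real ^ 'n) \<in> (\<lambda>v. A *v v + b) ` V" unfolding img by simp
    then obtain v where v: "v \<in> V" "A *v v + b = 0" by auto
    have "2 *\<^sub>R v \<in> V" "0 \<in> V" using v(1) unfolding V by auto
    then have "A *v (2 *\<^sub>R v) + b \<in> {y. \<forall>i. 0 \<le> y $ i}" "A *v 0 + b \<in> {y. \<forall>i. 0 \<le> y $ i}"
      unfolding img[symmetric] by blast+
    moreover have "A *v v = - b" using v(2) by (simp add: eq_neg_iff_add_eq_0)
    then have "A *v (2 *\<^sub>R v) + b = - b"
      unfolding matrix_vector_mult_scaleR by (simp add: scaleR_2)
    ultimately show ?thesis by (simp add: vec_eq_iff) (metis order_antisym)
  qed
  obtain B where B: "A ** B = mat 1" "B ** A = mat 1" using A unfolding invertible_def by blast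
  have AB: "A *v (B *v y) = y" for y by (simp add: matrix_vector_mul_assoc B)
  have BA: "B *v (A *v y) = y" for y by (simp add: matrix_vector_mul_assoc B)
  have orth: "A *v v \<in> {y. \<forall>i. 0 \<le> y $ i}" if "v \<in> V" for v using img that unfolding b by auto
  have orth': "B *v y \<in> V" if "\<forall>i. 0 \<le> y $ i" for y
  proof -
    have "y \<in> (\<lambda>v. A *v v + b) ` V" unfolding img using that by simp
    then obtain v where "v \<in> V" "y = A *v v" unfolding b by auto
    then show ?thesis by (simp add: BA)
  qed
  have Ai: "A $ i \<bullet> v = (A *v v) $ i" for i v by (simp add: matrix_vector_mult_def inner_vec_def)
  have "\<exists>i. (\<forall>y\<in>F. A $ i \<bullet> (y - x) = 0)" if F: "F \<in> active x" for F
  proof -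
    define w where "w = transpose B *v n F"
    have wy: "w \<bullet> y = n F \<bullet> (B *v y)" for y unfolding w_def by (simp add: dot_lmul_matrix)
    have wle: "w $ i \<le> 0" for i
    proof -
      have "n F \<bullet> (B *v axis i 1) \<le> 0" using orth'[of "axis i 1"] F unfolding V by (auto simp: axis_def)
      then show ?thesis unfolding wy[symmetric] by (simp add: inner_axis)
    qed
    have "w \<noteq> 0"
    proof
      assume "w = 0"
      then have "n F \<bullet> (B *v (A *v n F)) = 0" using wy[of "A *v n F"] by simp
      then show False using normals F unfolding BA active_def by force
    qed
    then obtain i where i: "w $ i \<noteq> 0" by (auto simp: vec_eq_iff)
    have "A $ i \<bullet> (y - x) = 0" if y: "y \<in> F" for y
    proof -
      have Fo: "F facet_of \<Omega>" "n F \<bullet> x = c F" using F unfolding active_def by auto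
      then have yO: "y \<in> \<Omega>" "n F \<bullet> y = c F" using y normals by blast+
      then have "1 *\<^sub>R (y - x) \<in> V" unfolding V_def tangent_cone_def by (intro CollectI exI[of _ 1] exI[of _ y]) auto
      then have z: "\<And>i. 0 \<le> (A *v (y - x)) $ i" using orth by auto
      \<comment> \<open>Complementary slackness: \<open>w\<close> is nonpositive and
        \<open>A *v (y - x)\<close> nonnegative in each coordinate, so a zero inner product makes
        every single product vanish.\<close>
      have "w \<bullet> (A *v (y - x)) = 0" unfolding wy BA using yO Fo by (simp add: inner_diff_right)
      then have "(\<Sum>i\<in>UNIV. w $ i * (A *v (y - x)) $ i) = 0" by (simp add: inner_vec_def)
      moreover have "w $ j * (A *v (y - x)) $ j \<le> 0" for j using wle z by (simp add: mult_nonpos_nonneg)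
      ultimately have "w $ i * (A *v (y - x)) $ i = 0"
        using sum_nonneg_eq_0_iff[of UNIV "\<lambda>i. - (w $ i * (A *v (y - x)) $ i)"]
        by (simp add: sum_negf)
      then show ?thesis using i Ai by simp
    qed
    then show ?thesis by blast
  qed
  then have "\<forall>F\<in>active x. \<exists>i. \<forall>y\<in>F. A $ i \<bullet> (y - x) = 0" by blast
  from bchoice[OF this] obtain \<iota>
    where \<iota>: "\<And>F y. F \<in> active x \<Longrightarrow> y \<in> F \<Longrightarrow> A $ \<iota> F \<bullet> (y - x) = 0" by blast
  have par: "\<exists>\<mu>. \<mu> \<noteq> 0 \<and> A $ \<iota> F = \<mu> *\<^sub>R n F" if F: "F \<in> active x" for F
  proof -
    have Fo: "F facet_of \<Omega>" using F unfolding active_def by auto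
    have "A $ \<iota> F = (n F \<bullet> A $ \<iota> F) *\<^sub>R n F"
      using normals[OF Fo] \<iota>[OF F]
      by (intro facet_functional_parallel[OF int Fo, where c = "c F" and e = "A $ \<iota> F \<bullet> x"])
        (auto simp: inner_diff_right)
    moreover have "A $ \<iota> F \<bullet> (B *v axis (\<iota> F) 1) = 1" unfolding Ai AB by simp
    then have "A $ \<iota> F \<noteq> 0" by force
    ultimately show ?thesis by (metis scaleR_zero_left)
  qed
  have inj\<iota>: "F \<subseteq> G" if FG: "F \<in> active x" "G \<in> active x" "\<iota> F = \<iota> G" for F G
  proof
    fix y assume y: "y \<in> F"
    then have yO: "y \<in> \<Omega>" using FG(1) facet_of_imp_subset unfolding active_def by blast
    obtain \<mu> where "\<mu> \<noteq> 0" "A $ \<iota> G = \<mu> *\<^sub>R n G" using par[OF FG(2)] by blast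
    then have "n G \<bullet> (y - x) = 0" using \<iota>[OF FG(1) y] FG(3) by simp
    then show "y \<in> G" using FG(2) yO mem_facet_iff unfolding active_def by (simp add: inner_diff_right)
  qed
  show ?thesis
  proof (rule independent_if_dual)
    show "finite (n ` active x)" using finite_active by simp
  next
    fix a assume "a \<in> n ` active x"
    then obtain F where F: "F \<in> active x" "a = n F" by blast
    define e where "e = B *v axis (\<iota> F) 1"
    have Ae: "A $ i \<bullet> e = (if i = \<iota> F then 1 else 0)" for i unfolding e_def Ai AB by (simp add: axis_def)
    have "n G \<bullet> e = 0" if G: "G \<in> active x" "n G \<noteq> n F" for G
    proof -
      have "\<iota> G \<noteq> \<iota> F" using inj\<iota>[of F G] inj\<iota>[of G F] F G by auto
      then have "A $ \<iota> G \<bullet> e = 0" using Ae by simp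
      then show ?thesis using par[OF G(1)] by auto
    qed
    moreover have "n F \<bullet> e \<noteq> 0" using par[OF F(1)] Ae[of "\<iota> F"] by auto
    ultimately show "\<exists>d. a \<bullet> d \<noteq> 0 \<and> (\<forall>b\<in>n ` active x. b \<noteq> a \<longrightarrow> b \<bullet> d = 0)"
      using F(2) by blast
  qed
qed

text \<open>Simplicity speaks of vertices only. The facets active at \<open>y\<close> meet in a
  face, and any vertex of that face lies on all of them, so their normals are among the independent
  normals at that vertex.\<close>

lemma simple_active_independent:
  assumes simple: "simple_polytope \<Omega>" and y: "y \<in> \<Omega>"
  shows "independent (n ` active y)"
proof (cases "active y = {}")
  case False
  define K where "K = \<Inter>(active y)"
  have "K face_of \<Omega>"
    unfolding K_def using False facet_of_imp_face_of by (intro face_of_Inter) (auto simp: active_def)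
  moreover have "y \<in> K" unfolding K_def using y mem_facet_iff by (auto simp: active_def)
  moreover have "polytope K" using polytope \<open>K face_of \<Omega>\<close> by (rule face_of_polytope_polytope)
  ultimately obtain x where x: "x extreme_point_of K"
    using extreme_point_exists_convex[of K] by (auto simp: polytope_imp_compact polytope_imp_convex)
  then have xO: "x extreme_point_of \<Omega>" "x \<in> K"
    using extreme_point_of_face[OF \<open>K face_of \<Omega>\<close>] by auto
  have "active y \<subseteq> active x"
    using xO y mem_facet_iff unfolding K_def active_def extreme_point_of_def by blast
  then show ?thesis
    using simple_extreme_independent[OF simple xO(1)] independent_mono by (metis image_mono)
qed (simp add: independent_empty)

text \<open>Compactness: if every 1 / (k + 1) failed, a limit \<open>y\<close> of counterexamples
  would lie on every facet that is near to late terms of the sequence, since a facet missing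
  \<open>y\<close> keeps a positive distance and there are finitely many facets.\<close>

lemma near_facets_meet:
  obtains \<delta> where "0 < \<delta>"
    "\<And>x. x \<in> \<Omega> \<Longrightarrow> \<exists>y\<in>\<Omega>. \<forall>F. F facet_of \<Omega> \<longrightarrow> c F - n F \<bullet> x < \<delta> \<longrightarrow> n F \<bullet> y = c F"
proof -
  let ?P = "\<lambda>\<delta>. \<forall>x\<in>\<Omega>. \<exists>y\<in>\<Omega>. \<forall>F. F facet_of \<Omega> \<longrightarrow> c F - n F \<bullet> x < \<delta> \<longrightarrow> n F \<bullet> y = c F"
  have "\<exists>k. ?P (1 / real (Suc k))"
  proof (rule ccontr)
    assume "\<not> ?thesis"
    then have "\<forall>k. \<exists>x\<in>\<Omega>. \<forall>y\<in>\<Omega>. \<exists>F. F facet_of \<Omega> \<and> c F - n F \<bullet> x < 1 / real (Suc k) \<and> n F \<bullet> y \<noteq> c F"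
      by blast
    then obtain X where X: "\<And>k. X k \<in> \<Omega>"
      "\<And>k y. y \<in> \<Omega> \<Longrightarrow> \<exists>F. F facet_of \<Omega> \<and> c F - n F \<bullet> X k < 1 / real (Suc k) \<and> n F \<bullet> y \<noteq> c F"
      by metis
    have "seq_compact \<Omega>" using polytope by (simp add: polytope_imp_compact compact_imp_seq_compact)
    then obtain y r where yr: "y \<in> \<Omega>" "strict_mono r" "(X \<circ> r) \<longlonglongrightarrow> y"
      using X(1) unfolding seq_compact_def by metis
    have "\<forall>\<^sub>F k in sequentially. c F - n F \<bullet> X (r k) < 1 / real (Suc (r k)) \<longrightarrow> n F \<bullet> y = c F"
      if F: "F facet_of \<Omega>" for F
    proof (cases "n F \<bullet> y = c F")
      case False
      then have pos: "0 < c F - n F \<bullet> y" using normals[OF F] yr(1) by (simp add: order_less_le)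
      have lim: "(\<lambda>k. (c F - n F \<bullet> X (r k)) - 1 / real (Suc (r k))) \<longlonglongrightarrow> (c F - n F \<bullet> y) - 0"
      proof (intro tendsto_intros)
        show "(\<lambda>k. X (r k)) \<longlonglongrightarrow> y" using yr(3) by (simp add: comp_def)
        show "(\<lambda>k. 1 / real (Suc (r k))) \<longlonglongrightarrow> 0"
          using LIMSEQ_subseq_LIMSEQ[OF LIMSEQ_inverse_real_of_nat yr(2)]
          by (simp add: comp_def inverse_eq_divide)
      qed
      from order_tendstoD(1)[OF lim, of 0] pos
      have "\<forall>\<^sub>F k in sequentially. 0 < (c F - n F \<bullet> X (r k)) - 1 / real (Suc (r k))"
        by simp
      then show ?thesis by eventually_elim simp
    qed simp
    then have "\<forall>\<^sub>F k in sequentially. \<forall>F\<in>{F. F facet_of \<Omega>}.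
        c F - n F \<bullet> X (r k) < 1 / real (Suc (r k)) \<longrightarrow> n F \<bullet> y = c F"
      by (intro eventually_ball_finite[OF finite_facets]) blast
    then obtain k where "\<forall>F\<in>{F. F facet_of \<Omega>}. c F - n F \<bullet> X (r k) < 1 / real (Suc (r k)) \<longrightarrow> n F \<bullet> y = c F"
      using eventually_happens'[OF sequentially_bot] by blast
    then show False using X(2)[OF yr(1), of "r k"] by blast
  qed
  then obtain k where "?P (1 / real (Suc k))" by blast
  then show ?thesis using that[of "1 / real (Suc k)"] by simp
qed

text \<open>A proper nonempty face is the intersection of the facets containing it; with no facet or
  only one, the dimension of that intersection would exceed the bound.\<close>

lemma skeleton_two_facets:
  assumes card: "CARD('n) \<ge> 2" and x: "x \<in> skeleton (CARD('n) - 2) \<Omega>"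
  obtains F G where "F \<in> active x" "G \<in> active x" "F \<noteq> G" "x \<in> \<Omega>"
proof -
  obtain K where K: "K face_of \<Omega>" "aff_dim K \<le> int (CARD('n) - 2)" "x \<in> K"
    using x unfolding skeleton_def by blast
  have dO: "aff_dim \<Omega> = int CARD('n)" using int by (simp add: aff_dim_nonempty_interior)
  \<comment> \<open>The truncated subtraction in the skeleton index is a true one because of
    \<open>card\<close>.\<close>
  have dK: "aff_dim K \<le> int CARD('n) - 2" using K(2) card by simp
  then have "K \<noteq> \<Omega>" using dO by auto
  then have Keq: "K = \<Inter>{F. F facet_of \<Omega> \<and> K \<subseteq> F}"
    using face_of_polyhedron[OF polyhedron_Omega K(1)] K(3) by blast
  have xO: "x \<in> \<Omega>" using K face_of_imp_subset by blast
  have act: "F \<in> active x" if "F facet_of \<Omega>" "K \<subseteq> F" for F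
    using that K(3) xO mem_facet_iff unfolding active_def by blast
  obtain F where F: "F facet_of \<Omega>" "K \<subseteq> F"
  proof (rule ccontr)
    assume "\<not> thesis"
    then have "{F. F facet_of \<Omega> \<and> K \<subseteq> F} = {}" using that by blast
    then have "K = UNIV" using Keq by (metis Inter_empty)
    then show False using dK by simp
  qed
  obtain G where G: "G facet_of \<Omega>" "K \<subseteq> G" "G \<noteq> F"
  proof (rule ccontr)
    assume "\<not> thesis"
    then have "{F. F facet_of \<Omega> \<and> K \<subseteq> F} = {F}" using that F by blast
    then have "K = F" using Keq by (metis cInf_singleton)
    then show False using dK F(1) dO unfolding facet_of_def by simp
  qed
  show ?thesis using that[of F G] act F G xO by blast
qed

end

section \<open>The A-condition on simple polytopes\<close>

context facet_normals
begin

lemma unit_normal: "F \<in> active x \<Longrightarrow> norm (n F) = 1"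
  using normals unfolding active_def by blast

text \<open>Removes the normalising transformation. The vectors \<open>d F\<close> are the facet
  normals in normalised coordinates, and their inner products are expressed through solutions of a
  linear system with the Hessian, so no explicit inverse is needed.\<close>

lemma Theta_le_if_hessian_sign:
  assumes card: "CARD('n) \<ge> 2" and x: "x \<in> skeleton (CARD('n) - 2) \<Omega>"
    and u: "uniformly_convex \<Omega> u"
    and sign: "\<And>F G z. F \<in> active x \<Longrightarrow> G \<in> active x \<Longrightarrow> F \<noteq> G \<Longrightarrow>
      hessian \<Omega> u x *v z = n G \<Longrightarrow> n F \<bullet> z \<le> 0"
  shows "Theta u x \<Omega> \<le> pi / 2"
proof -
  obtain F1 F2 where F12: "F1 \<in> active x" "F2 \<in> active x" "F1 \<noteq> F2" and xO: "x \<in> \<Omega>"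
    using skeleton_two_facets[OF card x] .
  obtain A :: "real ^ 'n ^ 'n" where A: "invertible A" "transpose A ** hessian \<Omega> u x ** A = mat 1"
    and TA: "Theta u x \<Omega> = Max {dihedral_angle {v. A *v v \<in> tangent_cone \<Omega> x} F G | F G.
       adjacent_facets {v. A *v v \<in> tangent_cone \<Omega> x} F G}"
    by (rule Theta_normalised[OF convex_Omega int u xO])
  define V where "V = {v. A *v v \<in> tangent_cone \<Omega> x}"
  define d where "d = (\<lambda>F. transpose A *v n F)"
  note V = linear_vimage_tangent_cone[OF A(1) xO, folded V_def d_def]
  have V1: "V = {v. \<forall>F\<in>active x. d F \<bullet> v \<le> 0}" using V(1) unfolding d_def .
  obtain B where B: "A ** B = mat 1" "B ** A = mat 1" using A(1) unfolding invertible_def by blast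
  have tinj: "y = z" if "transpose A *v y = transpose A *v z" for y z
  proof -
    have "transpose B *v (transpose A *v w) = w" for w
      by (metis B(1) matrix_transpose_mul matrix_vector_mul_assoc matrix_vector_mul_lid transpose_mat)
    then show ?thesis using that by metis
  qed
  have d0: "d F \<noteq> 0" if "F \<in> active x" for F
  proof
    assume "d F = 0"
    then have "n F = 0" using tinj[of "n F" 0] unfolding d_def by simp
    then show False using unit_normal[OF that] by simp
  qed
  \<comment> \<open>Required by \<open>adjacent_facets_exist\<close>. Equal normals at the same
    point belong to the same facet, and opposite ones would flatten the polytope into a
    hyperplane.\<close>
  have npar: "\<exists>G\<in>active x. \<forall>r. d G \<noteq> r *\<^sub>R d F" if F: "F \<in> active x" for F
  proof -
    obtain G where G: "G \<in> active x" "G \<noteq> F" using F12 by metis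
    have "d G \<noteq> r *\<^sub>R d F" for r
    proof
      assume "d G = r *\<^sub>R d F"
      then have eq: "n G = r *\<^sub>R n F"
        using tinj[of "n G" "r *\<^sub>R n F"] unfolding d_def by (simp add: matrix_vector_mult_scaleR)
      then have "\<bar>r\<bar> = 1" using unit_normal[OF F] unit_normal[OF G(1)] by simp
      then consider "r = 1" | "r = -1" by linarith
      then show False
      proof cases
        case 1
        then show False using eq G F inj_on_active[of x] by (simp add: inj_on_def)
      next
        case 2
        obtain p where p: "p \<in> interior \<Omega>" using int by blast
        have "\<Omega> \<subseteq> {y. n F \<bullet> y = c F}"
        proof
          fix y assume "y \<in> \<Omega>"
          then have "n F \<bullet> y \<le> c F" "n G \<bullet> y \<le> c G" using normals F G unfolding active_def by blast+
          moreover have "n F \<bullet> x = c F" "n G \<bullet> x = c G" using F G unfolding active_def by auto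
          ultimately show "y \<in> {y. n F \<bullet> y = c F}" using eq 2 by simp
        qed
        then have "interior {y. n F \<bullet> y = c F} \<noteq> {}" using p interior_mono by blast
        moreover have "n F \<noteq> 0" using unit_normal[OF F] by force
        ultimately show False using interior_hyperplane by blast
      qed
    qed
    then show ?thesis using G by blast
  qed
  have le: "dihedral_angle V F' G' \<le> pi / 2" if adj: "adjacent_facets V F' G'" for F' G'
  proof -
    have F': "F' facet_of V" "G' facet_of V" "F' \<noteq> G'" using adj unfolding adjacent_facets_def by auto
    obtain F where F: "F \<in> active x" "F' = V \<inter> {v. d F \<bullet> v = 0}" "outer_normal V F' = sgn (d F)"
      using facet_of_halfspaces_cone[OF finite_active V1 V(2) d0 F'(1)] by blast
    obtain G where G: "G \<in> active x" "G' = V \<inter> {v. d G \<bullet> v = 0}" "outer_normal V G' = sgn (d G)"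
      using facet_of_halfspaces_cone[OF finite_active V1 V(2) d0 F'(2)] by blast
    have FG: "F \<noteq> G" using F G F'(3) by blast
    \<comment> \<open>\<open>A ** transpose A\<close> inverts the Hessian, and moving one factor to
      the other side turns \<open>n F \<bullet> z\<close> into
      \<open>d F \<bullet> d G\<close>.\<close>
    define z where "z = A *v (transpose A *v n G)"
    have "transpose A *v (hessian \<Omega> u x *v z) = transpose A *v n G"
      unfolding z_def matrix_vector_mul_assoc[of "transpose A"] matrix_vector_mul_assoc[of _ A]
      by (metis A(2) matrix_mul_lid matrix_vector_mul_assoc)
    then have "hessian \<Omega> u x *v z = n G" by (rule tinj)
    then have "n F \<bullet> z \<le> 0" using sign F(1) G(1) FG by blast
    then have "d F \<bullet> d G \<le> 0" unfolding z_def d_def by (simp add: dot_lmul_matrix)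
    then have "outer_normal V F' \<bullet> outer_normal V G' \<le> 0"
      unfolding F(3) G(3) by (simp add: sgn_div_norm mult_nonneg_nonpos)
    then show ?thesis
      using dihedral_nonobtuse_iff[of V F' G'] F(3) G(3) d0 F(1) G(1) by (simp add: norm_sgn)
  qed
  obtain F' G' where FG': "adjacent_facets V F' G'"
    using adjacent_facets_exist[OF finite_active _ V1 V(2) d0 npar] F12 by blast
  note finite_dihedral_angles[OF V(3)]
  then show ?thesis
    unfolding TA V_def[symmetric] using FG' le by (subst Max_le_iff) blast+
qed

lemma ridge_potential_uniformly_convex:
  assumes "0 \<le> K"
  shows "C2_on \<Omega> (ridge_potential K P m b)" "uniformly_convex \<Omega> (ridge_potential K P m b)"
    and "x \<in> \<Omega> \<Longrightarrow> hessian \<Omega> (ridge_potential K P m b) x *v v = ridge_hessian K P m b x v"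
proof -
  note C = ridge_potential_C2_derivs[of \<Omega> K P m b]
  show C2: "C2_on \<Omega> (ridge_potential K P m b)" unfolding C2_on_def using C by blast
  show h: "hessian \<Omega> (ridge_potential K P m b) x *v v = ridge_hessian K P m b x v" if "x \<in> \<Omega>" for x v
    using hessian_eq[OF convex_Omega int C that]
    by (simp add: matrix_works linear_matrix_vector_mul_eq linear_ridge_hessian)
  have "\<forall>x\<in>\<Omega>. \<forall>\<xi>. 1 * (norm \<xi>)\<^sup>2 \<le> \<xi> \<bullet> (hessian \<Omega> (ridge_potential K P m b) x *v \<xi>)"
    using h ridge_hessian_quadratic[OF assms, of _ P m b] by (simp add: power2_norm_eq_inner)
  then show "uniformly_convex \<Omega> (ridge_potential K P m b)"
    unfolding uniformly_convex_def using C2 zero_less_one by blast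
qed

lemma simple_imp_A_condition:
  assumes card: "CARD('n) = 2 \<or> CARD('n) = 3" and simple: "simple_polytope \<Omega>"
  shows "\<exists>u. C2_on \<Omega> u \<and> convex_on \<Omega> u \<and> A_condition u \<Omega>"
proof -
  obtain \<delta> where \<delta>: "0 < \<delta>"
    "\<And>x. x \<in> \<Omega> \<Longrightarrow> \<exists>y\<in>\<Omega>. \<forall>F. F facet_of \<Omega> \<longrightarrow> c F - n F \<bullet> x < \<delta> \<longrightarrow> n F \<bullet> y = c F"
    using near_facets_meet by blast
  define S where "S = {F. F facet_of \<Omega>}"
  have finS: "finite S" unfolding S_def by (rule finite_facets)
  \<comment> \<open>The conditions on the normals are premises inside the predicate, so every pair
    has a threshold. This allows \<open>K\<close> to be fixed for all pairs, and below for all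
    triples, before any point is considered.\<close>
  let ?E = "\<lambda>(F, G) K. \<bar>n F \<bullet> n G\<bar> < 1 \<longrightarrow> (\<forall>z. z + K *\<^sub>R (((n F + n G) \<bullet> z) *\<^sub>R (n F + n G)) = n G \<longrightarrow>
      0 \<le> n G \<bullet> z \<longrightarrow> n F \<bullet> z \<le> 0)"
  have unit: "norm (n F) = 1" if "F \<in> S" for F using that normals unfolding S_def by blast
  have "\<exists>K0. \<forall>s\<in>S \<times> S. \<forall>K\<ge>K0. ?E s K"
  proof (rule finite_uniform_bound)
    show "finite (S \<times> S)" using finS by simp
    fix s assume "s \<in> S \<times> S"
    then obtain F G where s: "s = (F, G)" "F \<in> S" "G \<in> S" by auto
    show "\<exists>K0. \<forall>K\<ge>K0. ?E s K"
    proof (cases "\<bar>n F \<bullet> n G\<bar> < 1")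
      case True
      then show ?thesis using edge_sign[OF unit[OF s(2)] unit[OF s(3)]] s(1) by simp
    qed (use s in simp)
  qed
  then obtain K1 where K1: "\<And>F G K z. F \<in> S \<Longrightarrow> G \<in> S \<Longrightarrow> K1 \<le> K \<Longrightarrow> \<bar>n F \<bullet> n G\<bar> < 1 \<Longrightarrow>
     z + K *\<^sub>R (((n F + n G) \<bullet> z) *\<^sub>R (n F + n G)) = n G \<Longrightarrow> 0 \<le> n G \<bullet> z \<Longrightarrow> n F \<bullet> z \<le> 0"
    by fast
  let ?C = "\<lambda>(F, G, H) K. \<bar>n F \<bullet> n G\<bar> < 1 \<longrightarrow> n H \<notin> span {n F, n G} \<longrightarrow>
    (\<forall>\<tau> z. 0 \<le> \<tau> \<longrightarrow> \<tau> \<le> 1 \<longrightarrow>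
    z + K *\<^sub>R (((n F + n G) \<bullet> z) *\<^sub>R (n F + n G) + \<tau> *\<^sub>R (((n F + n H) \<bullet> z) *\<^sub>R (n F + n H)
      + ((n G + n H) \<bullet> z) *\<^sub>R (n G + n H))) = n G \<longrightarrow> 0 \<le> n G \<bullet> z \<longrightarrow> n F \<bullet> z \<le> 0)"
  have "\<exists>K0. \<forall>s\<in>S \<times> S \<times> S. \<forall>K\<ge>K0. ?C s K"
  proof (rule finite_uniform_bound)
    show "finite (S \<times> S \<times> S)" using finS by simp
    fix s assume "s \<in> S \<times> S \<times> S"
    then obtain F G H where s: "s = (F, G, H)" "F \<in> S" "G \<in> S" "H \<in> S" by auto
    show "\<exists>K0. \<forall>K\<ge>K0. ?C s K"
    proof (cases "\<bar>n F \<bullet> n G\<bar> < 1 \<and> n H \<notin> span {n F, n G}")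
      case True
      then show ?thesis using corner_sign[OF unit[OF s(2)] unit[OF s(3)], of "n H"] s(1) by simp
    qed (use s in auto)
  qed
  then obtain K2 where K2: "\<And>F G H K \<tau> z. F \<in> S \<Longrightarrow> G \<in> S \<Longrightarrow> H \<in> S \<Longrightarrow> K2 \<le> K \<Longrightarrow> \<bar>n F \<bullet> n G\<bar> < 1 \<Longrightarrow>
     n H \<notin> span {n F, n G} \<Longrightarrow> 0 \<le> \<tau> \<Longrightarrow> \<tau> \<le> 1 \<Longrightarrow>
     z + K *\<^sub>R (((n F + n G) \<bullet> z) *\<^sub>R (n F + n G) + \<tau> *\<^sub>R (((n F + n H) \<bullet> z) *\<^sub>R (n F + n H)
      + ((n G + n H) \<bullet> z) *\<^sub>R (n G + n H))) = n G \<Longrightarrow> 0 \<le> n G \<bullet> z \<Longrightarrow> n F \<bullet> z \<le> 0"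
    by fast
  define K where "K = max 0 (max K1 K2)"
  define P where "P = {(F, G) \<in> S \<times> S. F \<noteq> G}"
  define m where "m = (\<lambda>(F, G). n F + n G)"
  define b where "b = (\<lambda>(F, G). \<delta> - c F - c G)"
  \<comment> \<open>\<open>P\<close> consists of ordered pairs, so each pair of facets counts twice,
    and on the intersection of two facets the positive part equals \<delta>. Dividing by
    \<open>2 * \<delta>\<close> makes the effective coefficient there exactly
    \<open>K\<close>.\<close>
  define u where "u = ridge_potential (K / (2 * \<delta>)) P m b"
  have K0: "0 \<le> K / (2 * \<delta>)" "K1 \<le> K" "K2 \<le> K" using \<delta>(1) unfolding K_def by auto
  have finP: "finite P" unfolding P_def using finS by (rule_tac finite_subset[of _ "S \<times> S"]) auto
  note u = ridge_potential_uniformly_convex[OF K0(1), where P = P and m = m and b = b, folded u_def]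
  have sign: "n F \<bullet> z \<le> 0"
    if F: "F \<in> active x" and G: "G \<in> active x" and FG: "F \<noteq> G" and xO: "x \<in> \<Omega>"
      and z: "hessian \<Omega> u x *v z = n G" for x F G z
  proof -
    have b0: "0 \<le> n G \<bullet> z"
      using ridge_hessian_quadratic[OF K0(1), of z P m b x] z unfolding u(3)[OF xO]
      by (metis inner_commute inner_ge_zero order_trans)
    define L where "L = (\<lambda>F. c F - n F \<bullet> x)"
    \<comment> \<open>Distances are nonnegative, so a pair with a member outside \<open>N\<close>
      has a vanishing positive part; the Hessian at \<open>x\<close> involves only pairs from
      \<open>N\<close>.\<close>
    define N where "N = {F \<in> S. L F < \<delta>}"
    have L0: "0 \<le> L F" if "F \<in> S" for F using that normals xO unfolding S_def L_def by auto
    have FGS: "F \<in> S" "G \<in> S" "L F = 0" "L G = 0" "F \<in> N" "G \<in> N"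
      using F G \<delta>(1) unfolding active_def S_def N_def L_def by auto
    obtain y where y: "y \<in> \<Omega>" "\<And>F. F facet_of \<Omega> \<Longrightarrow> c F - n F \<bullet> x < \<delta> \<Longrightarrow> n F \<bullet> y = c F"
      using \<delta>(2)[OF xO] by blast
    have Ny: "N \<subseteq> active y" using y(2) unfolding N_def S_def L_def active_def by blast
    then have ind: "independent (n ` N)"
      using simple_active_independent[OF simple y(1)] independent_mono by (metis image_mono)
    have injN: "inj_on n N" using inj_on_active Ny by (rule inj_on_subset)
    have finN: "finite N" unfolding N_def using finS by simp
    \<comment> \<open>All facets of \<open>N\<close> pass through \<open>y\<close>, so their normals
      are independent and at most as many as the dimension. This is where dimension at most three
      leaves room for a single further facet.\<close>
    have "card N \<le> CARD('n)"
      using independent_card_le[OF ind] card_image[OF injN] by simp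
    then have cardN: "card N \<le> 3" using card by linarith
    have nFG: "n F \<noteq> n G" using injN FGS FG by (auto simp: inj_on_def)
    have "independent {n G, n F}" using ind by (rule independent_mono) (use FGS in auto)
    then have nsp: "n G \<notin> span {n F}" using nFG by (simp add: independent_insert)
    have lt1: "\<bar>n F \<bullet> n G\<bar> < 1"
    proof -
      have "\<bar>n F \<bullet> n G\<bar> \<le> 1" using Cauchy_Schwarz_ineq2[of "n F" "n G"] unit FGS by simp
      moreover have "\<bar>n F \<bullet> n G\<bar> \<noteq> 1"
      proof
        assume "\<bar>n F \<bullet> n G\<bar> = 1"
        then have "n G = n F \<or> n G = - n F"
          using norm_cauchy_schwarz_abs_eq[of "n F" "n G"] unit FGS by auto
        then show False using nsp by (metis span_base span_neg singletonI)
      qed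
      ultimately show ?thesis by linarith
    qed
    define q where "q = (\<lambda>k. (max 0 (m k \<bullet> x + b k) * (m k \<bullet> z)) *\<^sub>R m k)"
    have arg: "m (F, G) \<bullet> x + b (F, G) = \<delta> - L F - L G" for F G
      unfolding m_def b_def L_def by (simp add: inner_add_left)
    have q0: "q (F, G) = 0" if "F \<in> S" "G \<in> S" "\<not> (F \<in> N \<and> G \<in> N)" for F G
    proof -
      have "\<delta> - L F - L G \<le> 0" using that L0[OF that(1)] L0[OF that(2)] unfolding N_def by auto
      then show ?thesis unfolding q_def arg by simp
    qed
    have qs: "q (F, G) = q (G, F)" for F G
    proof -
      have "m (F, G) = m (G, F)" "b (F, G) = b (G, F)" by (simp_all add: m_def b_def)
      then show ?thesis unfolding q_def by simp
    qed
    have "ridge_hessian (K / (2 * \<delta>)) P m b x z = z + (K / (2 * \<delta>)) *\<^sub>R sum q P"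
      unfolding ridge_hessian_def q_def ..
    also have "sum q P = sum q {(F, G) \<in> N \<times> N. F \<noteq> G}"
      using q0 finP by (intro sum.mono_neutral_right) (auto simp: P_def N_def)
    finally have Hz: "z + (K / (2 * \<delta>)) *\<^sub>R sum q {(F, G) \<in> N \<times> N. F \<noteq> G} = n G"
      using z u(3)[OF xO] by simp
    have qFG: "q (F, G) = (\<delta> * ((n F + n G) \<bullet> z)) *\<^sub>R (n F + n G)"
      unfolding q_def arg using \<delta>(1) FGS by (simp add: m_def)
    show ?thesis
    proof (cases "N = {F, G}")
      case True
      then have "{(F, G) \<in> N \<times> N. F \<noteq> G} = {(F, G), (G, F)}" using FG by auto
      then have "sum q {(F, G) \<in> N \<times> N. F \<noteq> G} = 2 *\<^sub>R q (F, G)"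
        using FG qs[of G F] by (simp add: scaleR_2)
      then have "z + K *\<^sub>R (((n F + n G) \<bullet> z) *\<^sub>R (n F + n G)) = n G"
        using Hz \<delta>(1) unfolding qFG by simp
      then show ?thesis using K1[OF FGS(1,2) K0(2) lt1 _ b0] by blast
    next
      case False
      then obtain H where H: "H \<in> N" "H \<noteq> F" "H \<noteq> G" using FGS by blast
      have NFGH: "N = {F, G, H}"
      proof (rule card_seteq[symmetric, OF finN])
        show "{F, G, H} \<subseteq> N" using FGS H by auto
        show "card N \<le> card {F, G, H}" using cardN FG H by simp
      qed
      have "(p \<in> {(F, G) \<in> N \<times> N. F \<noteq> G}) = (p \<in> {(F, G), (G, F), (F, H), (H, F), (G, H), (H, G)})" for p
      proof (cases p)
        case (Pair a1 a2)
        show ?thesis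
          using FG H(2,3) FG[symmetric] H(2,3)[symmetric] unfolding Pair NFGH
          by (cases "a1 = F"; cases "a1 = G"; cases "a1 = H"; simp) blast+
      qed
      then have "{(F, G) \<in> N \<times> N. F \<noteq> G} = {(F, G), (G, F), (F, H), (H, F), (G, H), (H, G)}"
        by (rule set_eqI)
      then have "sum q {(F, G) \<in> N \<times> N. F \<noteq> G} = 2 *\<^sub>R (q (F, G) + (q (F, H) + q (G, H)))"
        using FG H qs[of G F] qs[of H F] qs[of H G] by (simp add: scaleR_2 algebra_simps)
      \<comment> \<open>As \<open>x\<close> lies on \<open>F\<close> and \<open>G\<close>, both
        pairs with \<open>H\<close> have positive part \<open>\<delta> - L H\<close>; relative to
        the value \<delta> for the pair \<open>F\<close>, \<open>G\<close> this is the weight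
        required by \<open>corner_sign\<close>.\<close>
      moreover define \<tau> where "\<tau> = (\<delta> - L H) / \<delta>"
      have HS: "H \<in> S" "L H < \<delta>" using H(1) unfolding N_def by auto
      have \<tau>: "0 \<le> \<tau>" "\<tau> \<le> 1" "\<delta> - L H = \<delta> * \<tau>" using HS L0[OF HS(1)] \<delta>(1) unfolding \<tau>_def by auto
      have "q (F, H) = (\<delta> * \<tau> * ((n F + n H) \<bullet> z)) *\<^sub>R (n F + n H)"
        "q (G, H) = (\<delta> * \<tau> * ((n G + n H) \<bullet> z)) *\<^sub>R (n G + n H)"
        unfolding q_def arg FGS(3,4) using \<delta>(1) \<tau> by (simp_all add: m_def)
      ultimately have "z + K *\<^sub>R (((n F + n G) \<bullet> z) *\<^sub>R (n F + n G) + \<tau> *\<^sub>R (((n F + n H) \<bullet> z) *\<^sub>R (n F + n H)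
          + ((n G + n H) \<bullet> z) *\<^sub>R (n G + n H))) = n G"
        using Hz \<delta>(1) unfolding qFG by (simp add: scaleR_add_right mult.assoc)
      moreover have "n H \<notin> span {n F, n G}"
      proof -
        have "independent {n H, n F, n G}" using ind by (rule independent_mono) (use FGS H in auto)
        moreover have "n H \<notin> {n F, n G}" using injN FGS H by (auto simp: inj_on_def)
        ultimately show ?thesis by (simp add: independent_insert)
      qed
      ultimately show ?thesis using K2[OF FGS(1,2) HS(1) K0(3) lt1 _ \<tau>(1,2) _ b0] by blast
    qed
  qed
  have "A_condition_at u x \<Omega>" if x: "x \<in> skeleton (CARD('n) - 2) \<Omega>" for x
  proof -
    have c2: "CARD('n) \<ge> 2" using card by auto
    have xO: "x \<in> \<Omega>" using x face_of_imp_subset unfolding skeleton_def by blast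
    show ?thesis
      unfolding A_condition_at_def using u(2) Theta_le_if_hessian_sign[OF c2 x u(2)] sign xO by blast
  qed
  moreover have "convex_on \<Omega> u"
    unfolding u_def by (rule convex_on_ridge_potential[OF K0(1) convex_Omega finP])
  ultimately show ?thesis unfolding A_condition_def using u(1) by blast
qed

end

theorem proposition5p1:
  fixes \<Omega> :: "(real ^ 'n) set"
  assumes "CARD('n) \<ge> 2" and "polytope \<Omega>" and "interior \<Omega> \<noteq> {}"
  shows "((\<exists>u. C2_on \<Omega> u \<and> convex_on \<Omega> u \<and> A_condition u \<Omega>) \<longrightarrow> simple_polytope \<Omega>) \<and>
         (CARD('n) = 2 \<or> CARD('n) = 3 \<longrightarrow> simple_polytope \<Omega> \<longrightarrow>
           (\<exists>u. C2_on \<Omega> u \<and> convex_on \<Omega> u \<and> A_condition u \<Omega>))"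
proof -
  have "\<forall>F. \<exists>n c. F facet_of \<Omega> \<longrightarrow>
      norm n = 1 \<and> (\<forall>x\<in>\<Omega>. n \<bullet> x \<le> c) \<and> F = \<Omega> \<inter> {x. n \<bullet> x = c}"
    using facet_unit_normal[OF polytope_imp_polyhedron[OF assms(2)]] by blast
  then obtain n c where "\<And>F. F facet_of \<Omega> \<Longrightarrow>
      norm (n F) = 1 \<and> (\<forall>x\<in>\<Omega>. n F \<bullet> x \<le> c F) \<and> F = \<Omega> \<inter> {x. n F \<bullet> x = c F}"
    by metis
  then interpret facet_normals \<Omega> n c
    using assms by unfold_locales
  show ?thesis
    using A_condition_imp_orthant[OF assms(1)] simple_imp_A_condition
    unfolding simple_polytope_def by blast
qed

end
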